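(* Let $\varphi\colon\Gamma\to G$ be a homomorphism of nilpotent groups. Then the canonical map $\varphi_\infty\colon\Gamma\to\Gamma_{\infty,\varphi}$ is an isomorphism.
   Context: Composition is written right to left. A normal map (= crossed module) is a group homomorphism $n\colon M\to G$ together with a right action $m\mapsto m^g$ of $G$ on $M$ by automorphisms such that $n(m^g)=g^{-1}n(m)g$ and $m^{n(m')}=m'^{-1}mm'$ for all $m,m'\in M$, $g\in G$. Given normal maps $n\colon M\to G$ and $n'\colon M'\to G$, a normal morphism over $G$ is a homomorphism $\mu\colon M\to M'$ with $n'\circ\mu=n$ and $\mu(m^g)=\mu(m)^g$ for all $m\in M$, $g\in G$. The (free) normal closure of a homomorphism $\varphi\colon\Gamma\to G$ is the universal factorization $\Gamma\xrightarrow{c_\varphi}\Gamma^{\varphi}\xrightarrow{\overline{\varphi}}G$ of $\varphi$ with $\overline{\varphi}$ a normal map: for every factorization $\varphi=n\circ\psi$ with $\psi\colon\Gamma\to M$ a homomorphism and $n\colon M\to G$ a normal map there is a unique normal morphism $u\colon\Gamma^\varphi\to M$ over $G$ with $u\circ c_\varphi=\psi$. It exists and is unique up to unique isomorphism. The normal closures tower of $\varphi$ is defined by $\Gamma_1=\Gamma_{1,\varphi}=G$, $\varphi_1=\varphi$, and inductively $\Gamma_{i+1}=\Gamma_{i+1,\varphi}=\Gamma^{\varphi_i}$ (the normal closure of $\varphi_i\colon\Gamma\to\Gamma_i$), $\varphi_{i+1}=c_{\varphi_i}\colon\Gamma\to\Gamma_{i+1}$, with normal map $\overline{\varphi_i}\colon\Gamma_{i+1}\to\Gamma_i$.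 Then $\Gamma_\infty=\Gamma_{\infty,\varphi}=\varprojlim\Gamma_i$ is the inverse limit of $\cdots\to\Gamma_3\to\Gamma_2\to\Gamma_1=G$, and $\varphi_\infty\colon\Gamma\to\Gamma_\infty$ is the map induced by the $\varphi_i$. *)

theory Defs
  imports "HOL-Algebra.Algebra"
begin

section \<open>Nilpotent groups\<close>

primrec lower_central :: "('a, 'm) monoid_scheme \<Rightarrow> nat \<Rightarrow> 'a set" where
  "lower_central G 0 = carrier G"
| "lower_central G (Suc k) = generate G
     (\<Union>x\<in>lower_central G k. \<Union>y\<in>carrier G. {x \<otimes>\<^bsub>G\<^esub> y \<otimes>\<^bsub>G\<^esub> inv\<^bsub>G\<^esub> x \<otimes>\<^bsub>G\<^esub> inv\<^bsub>G\<^esub> y})"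

definition nilpotent_group :: "('a, 'm) monoid_scheme \<Rightarrow> bool" where
  "nilpotent_group G \<longleftrightarrow> group G \<and> (\<exists>k. lower_central G k = {\<one>\<^bsub>G\<^esub>})"

section \<open>Normal maps and normal closures\<close>

definition right_action_by_automorphisms ::
    "'m monoid \<Rightarrow> 'g monoid \<Rightarrow> ('m \<Rightarrow> 'g \<Rightarrow> 'm) \<Rightarrow> bool" where
  "right_action_by_automorphisms M G act \<longleftrightarrow>
     (\<forall>g\<in>carrier G. (\<lambda>m. act m g) \<in> iso M M) \<and>
     (\<forall>m\<in>carrier M. act m \<one>\<^bsub>G\<^esub> = m) \<and>
     (\<forall>m\<in>carrier M. \<forall>g\<in>carrier G. \<forall>h\<in>carrier G. act m (g \<otimes>\<^bsub>G\<^esub> h) = act (act m g) h)"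

definition normal_map :: "'m monoid \<Rightarrow> 'g monoid \<Rightarrow> ('m \<Rightarrow> 'g) \<Rightarrow> ('m \<Rightarrow> 'g \<Rightarrow> 'm) \<Rightarrow> bool" where
  "normal_map M G n act \<longleftrightarrow>
     group M \<and> group G \<and> n \<in> hom M G \<and> right_action_by_automorphisms M G act \<and>
     (\<forall>m\<in>carrier M. \<forall>g\<in>carrier G. n (act m g) = inv\<^bsub>G\<^esub> g \<otimes>\<^bsub>G\<^esub> n m \<otimes>\<^bsub>G\<^esub> g) \<and>
     (\<forall>m\<in>carrier M. \<forall>m'\<in>carrier M. act m (n m') = inv\<^bsub>M\<^esub> m' \<otimes>\<^bsub>M\<^esub> m \<otimes>\<^bsub>M\<^esub> m')"

definition normal_morphism ::
    "'g monoid \<Rightarrow> 'm monoid \<Rightarrow> ('m \<Rightarrow> 'g) \<Rightarrow> ('m \<Rightarrow> 'g \<Rightarrow> 'm) \<Rightarrow>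
     'k monoid \<Rightarrow> ('k \<Rightarrow> 'g) \<Rightarrow> ('k \<Rightarrow> 'g \<Rightarrow> 'k) \<Rightarrow> ('m \<Rightarrow> 'k) \<Rightarrow> bool" where
  "normal_morphism G M n act M' n' act' \<mu> \<longleftrightarrow>
     \<mu> \<in> hom M M' \<and>
     (\<forall>m\<in>carrier M. n' (\<mu> m) = n m) \<and>
     (\<forall>m\<in>carrier M. \<forall>g\<in>carrier G. \<mu> (act m g) = act' (\<mu> m) g)"

definition normal_factorization ::
    "'a monoid \<Rightarrow> 'g monoid \<Rightarrow> ('a \<Rightarrow> 'g) \<Rightarrow>
     'm monoid \<Rightarrow> ('a \<Rightarrow> 'm) \<Rightarrow> ('m \<Rightarrow> 'g) \<Rightarrow> ('m \<Rightarrow> 'g \<Rightarrow> 'm) \<Rightarrow> bool" where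
  "normal_factorization \<Gamma> G \<phi> M \<psi> n act \<longleftrightarrow>
     normal_map M G n act \<and> \<psi> \<in> hom \<Gamma> M \<and> (\<forall>\<gamma>\<in>carrier \<Gamma>. n (\<psi> \<gamma>) = \<phi> \<gamma>)"

text \<open>
  HOL cannot quantify over types inside a formula, so the type of the groups against which the
  universal property is tested is a parameter. The choice does not matter for the closures used
  below: see \<open>normal_closure_universal\<close>. Homomorphisms are only determined on the carrier,
  hence \<^const>\<open>extensional\<close> in the uniqueness clause.
\<close>

definition is_normal_closure ::
    "'m itself \<Rightarrow> 'a monoid \<Rightarrow> 'g monoid \<Rightarrow> ('a \<Rightarrow> 'g) \<Rightarrow>
     'n monoid \<Rightarrow> ('a \<Rightarrow> 'n) \<Rightarrow> ('n \<Rightarrow> 'g) \<Rightarrow> ('n \<Rightarrow> 'g \<Rightarrow> 'n) \<Rightarrow> bool" where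
  "is_normal_closure (T :: 'm itself) \<Gamma> G \<phi> N c n act \<longleftrightarrow>
     normal_factorization \<Gamma> G \<phi> N c n act \<and>
     (\<forall>(M :: 'm monoid) \<psi> n' act'. normal_factorization \<Gamma> G \<phi> M \<psi> n' act' \<longrightarrow>
        (\<exists>!u. u \<in> extensional (carrier N) \<and> normal_morphism G N n act M n' act' u \<and>
              (\<forall>\<gamma>\<in>carrier \<Gamma>. u (c \<gamma>) = \<psi> \<gamma>)))"

text \<open>
  A single type for all stages of the tower: it contains a copy of \<open>G\<close> (through \<open>Base\<close>), and it
  is closed under forming words with letters in \<open>\<Gamma>\<^sub>i \<times> \<Gamma>\<close> (through \<open>Word\<close>), so that it has room
  for a normal closure of any homomorphism from \<open>\<Gamma>\<close> to a group on this type.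
\<close>

datatype ('a, 'b) stage = Base 'b | Word "(('a, 'b) stage \<times> 'a) list"

type_synonym ('a, 'b) closure =
  "('a, 'b) stage monoid \<times> ('a \<Rightarrow> ('a, 'b) stage) \<times> (('a, 'b) stage \<Rightarrow> ('a, 'b) stage) \<times>
   (('a, 'b) stage \<Rightarrow> ('a, 'b) stage \<Rightarrow> ('a, 'b) stage)"

definition normal_closure ::
    "'a monoid \<Rightarrow> ('a, 'b) stage monoid \<Rightarrow> ('a \<Rightarrow> ('a, 'b) stage) \<Rightarrow> ('a, 'b) closure" where
  "normal_closure \<Gamma> G \<phi> =
     (SOME (N, c, n, act). is_normal_closure TYPE(('a, 'b) stage) \<Gamma> G \<phi> N c n act)"

definition closure_group where
  "closure_group \<Gamma> G \<phi> = fst (normal_closure \<Gamma> G \<phi>)"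

definition closure_map where
  "closure_map \<Gamma> G \<phi> = fst (snd (normal_closure \<Gamma> G \<phi>))"

definition closure_normal_map where
  "closure_normal_map \<Gamma> G \<phi> = fst (snd (snd (normal_closure \<Gamma> G \<phi>)))"

definition closure_action where
  "closure_action \<Gamma> G \<phi> = snd (snd (snd (normal_closure \<Gamma> G \<phi>)))"

section \<open>The normal closures tower\<close>

definition base_group :: "'b monoid \<Rightarrow> ('a, 'b) stage monoid" where
  "base_group G = \<lparr>carrier = Base ` carrier G,
     monoid.mult = (\<lambda>x y. Base (the_inv Base x \<otimes>\<^bsub>G\<^esub> the_inv Base y)), one = Base \<one>\<^bsub>G\<^esub>\<rparr>"

text \<open>
  Index shift: \<open>tower \<Gamma> G \<phi> i\<close> is the pair \<open>(\<Gamma>\<^sub>i\<^sub>+\<^sub>1, \<phi>\<^sub>i\<^sub>+\<^sub>1)\<close>, so the tower starts at index \<open>0\<close>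
  with (the copy of) \<open>\<Gamma>\<^sub>1 = G\<close> and \<open>\<phi>\<^sub>1 = \<phi>\<close>.
\<close>

primrec tower ::
    "'a monoid \<Rightarrow> 'b monoid \<Rightarrow> ('a \<Rightarrow> 'b) \<Rightarrow> nat \<Rightarrow>
     ('a, 'b) stage monoid \<times> ('a \<Rightarrow> ('a, 'b) stage)" where
  "tower \<Gamma> G \<phi> 0 = (base_group G, Base \<circ> \<phi>)"
| "tower \<Gamma> G \<phi> (Suc i) =
     (case tower \<Gamma> G \<phi> i of (H, \<psi>) \<Rightarrow> (closure_group \<Gamma> H \<psi>, closure_map \<Gamma> H \<psi>))"

definition tower_group where
  "tower_group \<Gamma> G \<phi> i = fst (tower \<Gamma> G \<phi> i)"

definition tower_map where
  "tower_map \<Gamma> G \<phi> i = snd (tower \<Gamma> G \<phi> i)"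

definition tower_normal_map where
  "tower_normal_map \<Gamma> G \<phi> i = closure_normal_map \<Gamma> (tower_group \<Gamma> G \<phi> i) (tower_map \<Gamma> G \<phi> i)"

definition tower_action where
  "tower_action \<Gamma> G \<phi> i = closure_action \<Gamma> (tower_group \<Gamma> G \<phi> i) (tower_map \<Gamma> G \<phi> i)"

definition inverse_limit :: "(nat \<Rightarrow> 'c monoid) \<Rightarrow> (nat \<Rightarrow> 'c \<Rightarrow> 'c) \<Rightarrow> (nat \<Rightarrow> 'c) monoid" where
  "inverse_limit H p = (product_group UNIV H)
     \<lparr>carrier := {x \<in> carrier (product_group UNIV H). \<forall>i. p i (x (Suc i)) = x i}\<rparr>"

definition tower_limit :: "'a monoid \<Rightarrow> 'b monoid \<Rightarrow> ('a \<Rightarrow> 'b) \<Rightarrow> (nat \<Rightarrow> ('a, 'b) stage) monoid" where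
  "tower_limit \<Gamma> G \<phi> = inverse_limit (tower_group \<Gamma> G \<phi>) (tower_normal_map \<Gamma> G \<phi>)"

definition tower_limit_map :: "'a monoid \<Rightarrow> 'b monoid \<Rightarrow> ('a \<Rightarrow> 'b) \<Rightarrow> 'a \<Rightarrow> nat \<Rightarrow> ('a, 'b) stage" where
  "tower_limit_map \<Gamma> G \<phi> \<gamma> = (\<lambda>i. tower_map \<Gamma> G \<phi> i \<gamma>)"

section \<open>Existence of normal closures\<close>

text \<open>
  The normal closure of \<open>\<phi>\<close> is presented by letters \<open>(g, a)\<close>, standing for \<open>c(a)\<^sup>g\<close>, subject to
  the relations making each \<open>a \<mapsto> (g, a)\<close> a homomorphism and the Peiffer relations.
\<close>

definition words :: "'g monoid \<Rightarrow> 'a monoid \<Rightarrow> ('g \<times> 'a) list set" where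
  "words G \<Gamma> = lists (carrier G \<times> carrier \<Gamma>)"

lemma words_simps [simp]:
  "[] \<in> words G \<Gamma>"
  "x # w \<in> words G \<Gamma> \<longleftrightarrow> fst x \<in> carrier G \<and> snd x \<in> carrier \<Gamma> \<and> w \<in> words G \<Gamma>"
  "w @ v \<in> words G \<Gamma> \<longleftrightarrow> w \<in> words G \<Gamma> \<and> v \<in> words G \<Gamma>"
  by (cases x) (auto simp: words_def mem_Times_iff)

inductive word_cong :: "'a monoid \<Rightarrow> 'g monoid \<Rightarrow> ('a \<Rightarrow> 'g) \<Rightarrow> ('g \<times> 'a) list \<Rightarrow> ('g \<times> 'a) list \<Rightarrow> bool"
  for \<Gamma> G \<phi> where
  refl: "w \<in> words G \<Gamma> \<Longrightarrow> word_cong \<Gamma> G \<phi> w w"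
| sym: "word_cong \<Gamma> G \<phi> v w \<Longrightarrow> word_cong \<Gamma> G \<phi> w v"
| trans: "word_cong \<Gamma> G \<phi> u v \<Longrightarrow> word_cong \<Gamma> G \<phi> v w \<Longrightarrow> word_cong \<Gamma> G \<phi> u w"
| append: "word_cong \<Gamma> G \<phi> u v \<Longrightarrow> word_cong \<Gamma> G \<phi> u' v' \<Longrightarrow> word_cong \<Gamma> G \<phi> (u @ u') (v @ v')"
| one: "g \<in> carrier G \<Longrightarrow> word_cong \<Gamma> G \<phi> [(g, \<one>\<^bsub>\<Gamma>\<^esub>)] []"
| mult: "g \<in> carrier G \<Longrightarrow> a \<in> carrier \<Gamma> \<Longrightarrow> b \<in> carrier \<Gamma> \<Longrightarrow>
    word_cong \<Gamma> G \<phi> [(g, a), (g, b)] [(g, a \<otimes>\<^bsub>\<Gamma>\<^esub> b)]"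
| peiffer: "g \<in> carrier G \<Longrightarrow> h \<in> carrier G \<Longrightarrow> a \<in> carrier \<Gamma> \<Longrightarrow> b \<in> carrier \<Gamma> \<Longrightarrow>
    word_cong \<Gamma> G \<phi> [(g, a), (h, b)] [(h, b), (g \<otimes>\<^bsub>G\<^esub> (inv\<^bsub>G\<^esub> h \<otimes>\<^bsub>G\<^esub> \<phi> b \<otimes>\<^bsub>G\<^esub> h), a)]"

primrec word_eval :: "'m monoid \<Rightarrow> ('a \<Rightarrow> 'm) \<Rightarrow> ('m \<Rightarrow> 'g \<Rightarrow> 'm) \<Rightarrow> ('g \<times> 'a) list \<Rightarrow> 'm" where
  "word_eval M \<psi> act [] = \<one>\<^bsub>M\<^esub>"
| "word_eval M \<psi> act (x # w) = act (\<psi> (snd x)) (fst x) \<otimes>\<^bsub>M\<^esub> word_eval M \<psi> act w"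

definition word_act :: "'g monoid \<Rightarrow> ('g \<times> 'a) list \<Rightarrow> 'g \<Rightarrow> ('g \<times> 'a) list" where
  "word_act G w k = map (\<lambda>(g, a). (g \<otimes>\<^bsub>G\<^esub> k, a)) w"

definition conj_act :: "'g monoid \<Rightarrow> 'g \<Rightarrow> 'g \<Rightarrow> 'g" where
  "conj_act G m g = inv\<^bsub>G\<^esub> g \<otimes>\<^bsub>G\<^esub> m \<otimes>\<^bsub>G\<^esub> g"

lemma conj_act_simps:
  assumes "group G" and "m \<in> carrier G" "m' \<in> carrier G" "g \<in> carrier G" "h \<in> carrier G"
  shows "conj_act G m g \<in> carrier G"
    "conj_act G (m \<otimes>\<^bsub>G\<^esub> m') g = conj_act G m g \<otimes>\<^bsub>G\<^esub> conj_act G m' g"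
    "conj_act G m \<one>\<^bsub>G\<^esub> = m"
    "conj_act G m (g \<otimes>\<^bsub>G\<^esub> h) = conj_act G (conj_act G m g) h"
proof -
  interpret group G by fact
  show "conj_act G m g \<in> carrier G" "conj_act G m \<one>\<^bsub>G\<^esub> = m"
    using assms by (simp_all add: conj_act_def)
  show "conj_act G m (g \<otimes>\<^bsub>G\<^esub> h) = conj_act G (conj_act G m g) h"
    using assms by (simp add: conj_act_def inv_mult_group m_assoc)
  have "g \<otimes>\<^bsub>G\<^esub> (inv\<^bsub>G\<^esub> g \<otimes>\<^bsub>G\<^esub> (m' \<otimes>\<^bsub>G\<^esub> g)) = m' \<otimes>\<^bsub>G\<^esub> g"
    using assms by (simp flip: m_assoc)
  then show "conj_act G (m \<otimes>\<^bsub>G\<^esub> m') g = conj_act G m g \<otimes>\<^bsub>G\<^esub> conj_act G m' g"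
    using assms by (simp add: conj_act_def m_assoc)
qed

lemma right_action_by_automorphismsI:
  assumes "\<And>m g. m \<in> carrier M \<Longrightarrow> g \<in> carrier G \<Longrightarrow> act m g \<in> carrier M"
    and "\<And>m m' g. m \<in> carrier M \<Longrightarrow> m' \<in> carrier M \<Longrightarrow> g \<in> carrier G \<Longrightarrow>
           act (m \<otimes>\<^bsub>M\<^esub> m') g = act m g \<otimes>\<^bsub>M\<^esub> act m' g"
    and one: "\<And>m. m \<in> carrier M \<Longrightarrow> act m \<one>\<^bsub>G\<^esub> = m"
    and mult: "\<And>m g h. m \<in> carrier M \<Longrightarrow> g \<in> carrier G \<Longrightarrow> h \<in> carrier G \<Longrightarrow>
           act m (g \<otimes>\<^bsub>G\<^esub> h) = act (act m g) h"
    and "group G"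
  shows "right_action_by_automorphisms M G act"
proof -
  interpret group G by fact
  have "bij_betw (\<lambda>m. act m g) (carrier M) (carrier M)" if "g \<in> carrier G" for g
  proof (rule bij_betw_byWitness[where f' = "\<lambda>m. act m (inv\<^bsub>G\<^esub> g)"])
    show "\<forall>m\<in>carrier M. act (act m g) (inv\<^bsub>G\<^esub> g) = m"
      "\<forall>m\<in>carrier M. act (act m (inv\<^bsub>G\<^esub> g)) g = m"
      using that by (simp_all add: one flip: mult)
  qed (use assms that in auto)
  then show ?thesis
    using assms by (auto simp: right_action_by_automorphisms_def iso_def hom_def)
qed

lemma normal_factorization_id:
  assumes "group G" "\<phi> \<in> hom \<Gamma> G"
  shows "normal_factorization \<Gamma> G \<phi> G \<phi> (\<lambda>x. x) (conj_act G)"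
proof -
  have "right_action_by_automorphisms G G (conj_act G)"
    by (rule right_action_by_automorphismsI) (use assms in \<open>auto simp: conj_act_simps\<close>)
  then show ?thesis
    using assms by (auto simp: normal_factorization_def normal_map_def conj_act_def hom_def)
qed

lemma normal_mapD:
  assumes "normal_map M G n act"
  shows "group M" "group G" "n \<in> hom M G"
    "\<And>m. m \<in> carrier M \<Longrightarrow> n m \<in> carrier G"
    "\<And>m m'. m \<in> carrier M \<Longrightarrow> m' \<in> carrier M \<Longrightarrow> n (m \<otimes>\<^bsub>M\<^esub> m') = n m \<otimes>\<^bsub>G\<^esub> n m'"
    "n \<one>\<^bsub>M\<^esub> = \<one>\<^bsub>G\<^esub>"
    "\<And>m g. m \<in> carrier M \<Longrightarrow> g \<in> carrier G \<Longrightarrow> act m g \<in> carrier M"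
    "\<And>m m' g. m \<in> carrier M \<Longrightarrow> m' \<in> carrier M \<Longrightarrow> g \<in> carrier G \<Longrightarrow>
       act (m \<otimes>\<^bsub>M\<^esub> m') g = act m g \<otimes>\<^bsub>M\<^esub> act m' g"
    "\<And>g. g \<in> carrier G \<Longrightarrow> act \<one>\<^bsub>M\<^esub> g = \<one>\<^bsub>M\<^esub>"
    "\<And>m. m \<in> carrier M \<Longrightarrow> act m \<one>\<^bsub>G\<^esub> = m"
    "\<And>m g h. m \<in> carrier M \<Longrightarrow> g \<in> carrier G \<Longrightarrow> h \<in> carrier G \<Longrightarrow>
       act m (g \<otimes>\<^bsub>G\<^esub> h) = act (act m g) h"
    "\<And>m g. m \<in> carrier M \<Longrightarrow> g \<in> carrier G \<Longrightarrow>
       n (act m g) = inv\<^bsub>G\<^esub> g \<otimes>\<^bsub>G\<^esub> n m \<otimes>\<^bsub>G\<^esub> g"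
    "\<And>m m'. m \<in> carrier M \<Longrightarrow> m' \<in> carrier M \<Longrightarrow>
       act m (n m') = inv\<^bsub>M\<^esub> m' \<otimes>\<^bsub>M\<^esub> m \<otimes>\<^bsub>M\<^esub> m'"
proof -
  show *: "group M" "group G" "n \<in> hom M G"
    using assms by (auto simp: normal_map_def)
  then show "n \<one>\<^bsub>M\<^esub> = \<one>\<^bsub>G\<^esub>"
    by (simp add: hom_one)
  have hom: "(\<lambda>m. act m g) \<in> hom M M" if "g \<in> carrier G" for g
    using assms that by (auto simp: normal_map_def right_action_by_automorphisms_def iso_def)
  show "act \<one>\<^bsub>M\<^esub> g = \<one>\<^bsub>M\<^esub>" if "g \<in> carrier G" for g
    using hom_one[OF hom] * that by blast
  show "act m g \<in> carrier M" if "m \<in> carrier M" "g \<in> carrier G" for m g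
    using hom_in_carrier[OF hom] that by blast
  show "act (m \<otimes>\<^bsub>M\<^esub> m') g = act m g \<otimes>\<^bsub>M\<^esub> act m' g"
    if "m \<in> carrier M" "m' \<in> carrier M" "g \<in> carrier G" for m m' g
    using hom_mult[OF hom] that by blast
qed (use assms in \<open>auto simp: normal_map_def right_action_by_automorphisms_def hom_def\<close>)

lemma word_cong_lists:
  assumes "word_cong \<Gamma> G \<phi> w v" "group \<Gamma>" "group G" "\<phi> \<in> hom \<Gamma> G"
  shows "w \<in> words G \<Gamma>" "v \<in> words G \<Gamma>"
proof -
  interpret A: group \<Gamma> by fact
  interpret B: group G by fact
  have "w \<in> words G \<Gamma> \<and> v \<in> words G \<Gamma>"
    using assms(1) by induction (use assms in \<open>auto dest: hom_in_carrier\<close>)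
  then show "w \<in> words G \<Gamma>" "v \<in> words G \<Gamma>"
    by auto
qed

locale normal_factor =
  fixes \<Gamma> :: "'a monoid" and G :: "'g monoid" and \<phi> :: "'a \<Rightarrow> 'g"
    and M :: "'m monoid" and \<psi> :: "'a \<Rightarrow> 'm" and n :: "'m \<Rightarrow> 'g" and act :: "'m \<Rightarrow> 'g \<Rightarrow> 'm"
  assumes fac: "normal_factorization \<Gamma> G \<phi> M \<psi> n act" and gr: "group \<Gamma>"
begin

lemma nm: "normal_map M G n act"
  using fac by (simp add: normal_factorization_def)

lemmas nmD = normal_mapD[OF nm]

sublocale A: group \<Gamma> by (rule gr)
sublocale B: group G by (rule nmD)
sublocale M: group M by (rule nmD)

lemma psi: "a \<in> carrier \<Gamma> \<Longrightarrow> \<psi> a \<in> carrier M"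
  "a \<in> carrier \<Gamma> \<Longrightarrow> b \<in> carrier \<Gamma> \<Longrightarrow> \<psi> (a \<otimes>\<^bsub>\<Gamma>\<^esub> b) = \<psi> a \<otimes>\<^bsub>M\<^esub> \<psi> b"
  "\<psi> \<one>\<^bsub>\<Gamma>\<^esub> = \<one>\<^bsub>M\<^esub>" "a \<in> carrier \<Gamma> \<Longrightarrow> n (\<psi> a) = \<phi> a"
proof -
  have h: "\<psi> \<in> hom \<Gamma> M" using fac by (simp add: normal_factorization_def)
  show "\<psi> \<one>\<^bsub>\<Gamma>\<^esub> = \<one>\<^bsub>M\<^esub>" using hom_one[OF h gr M.is_group] .
  show "a \<in> carrier \<Gamma> \<Longrightarrow> \<psi> a \<in> carrier M"
    "a \<in> carrier \<Gamma> \<Longrightarrow> b \<in> carrier \<Gamma> \<Longrightarrow> \<psi> (a \<otimes>\<^bsub>\<Gamma>\<^esub> b) = \<psi> a \<otimes>\<^bsub>M\<^esub> \<psi> b"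
    using h by (auto simp: hom_def)
  show "a \<in> carrier \<Gamma> \<Longrightarrow> n (\<psi> a) = \<phi> a"
    using fac by (auto simp: normal_factorization_def)
qed

lemma phi: "a \<in> carrier \<Gamma> \<Longrightarrow> \<phi> a \<in> carrier G"
  using psi nmD by metis

abbreviation "W \<equiv> words G \<Gamma>"
abbreviation "ev \<equiv> word_eval M \<psi> act"
abbreviation "vl \<equiv> word_eval G \<phi> (conj_act G)"

lemma ev_closed: "w \<in> W \<Longrightarrow> ev w \<in> carrier M"
  by (induction w) (auto simp: psi nmD(7))

lemma ev_append: "w \<in> W \<Longrightarrow> v \<in> W \<Longrightarrow> ev (w @ v) = ev w \<otimes>\<^bsub>M\<^esub> ev v"
  by (induction w) (auto simp: psi nmD(7) ev_closed M.m_assoc)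

lemma n_ev: "w \<in> W \<Longrightarrow> n (ev w) = vl w"
  by (induction w) (auto simp: psi nmD ev_closed conj_act_def)

lemma word_act_closed: "w \<in> W \<Longrightarrow> k \<in> carrier G \<Longrightarrow> word_act G w k \<in> W"
  by (induction w) (auto simp: word_act_def)

lemma ev_word_act: "w \<in> W \<Longrightarrow> k \<in> carrier G \<Longrightarrow> ev (word_act G w k) = act (ev w) k"
  by (induction w) (auto simp: psi nmD ev_closed word_act_def)

lemma ev_cong:
  assumes "word_cong \<Gamma> G \<phi> w v"
  shows "ev w = ev v"
proof -
  have hom: "\<phi> \<in> hom \<Gamma> G"
  proof (rule homI)
    fix a b assume "a \<in> carrier \<Gamma>" "b \<in> carrier \<Gamma>"
    then show "\<phi> (a \<otimes>\<^bsub>\<Gamma>\<^esub> b) = \<phi> a \<otimes>\<^bsub>G\<^esub> \<phi> b"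
      using psi(4)[of "a \<otimes>\<^bsub>\<Gamma>\<^esub> b"] by (simp add: psi nmD(5))
  qed (rule phi)
  note L = word_cong_lists[OF _ gr B.is_group hom]
  show ?thesis
    using assms
  proof induction
    case (append u v u' v')
    then show ?case
      using L[OF append.hyps(1)] L[OF append.hyps(2)] by (simp add: ev_append)
  next
    case (mult g a b)
    then show ?case
      by (simp add: psi nmD)
  next
    case (peiffer g h a b)
    let ?m = "act (\<psi> a) g" and ?m' = "act (\<psi> b) h"
    have c: "?m \<in> carrier M" "?m' \<in> carrier M"
      using peiffer by (auto simp: psi nmD)
    have "n ?m' = inv\<^bsub>G\<^esub> h \<otimes>\<^bsub>G\<^esub> \<phi> b \<otimes>\<^bsub>G\<^esub> h"
      using peiffer by (simp add: nmD psi)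
    then have "act (\<psi> a) (g \<otimes>\<^bsub>G\<^esub> (inv\<^bsub>G\<^esub> h \<otimes>\<^bsub>G\<^esub> \<phi> b \<otimes>\<^bsub>G\<^esub> h)) = act ?m (n ?m')"
      using peiffer by (simp add: nmD psi phi)
    also have "\<dots> = inv\<^bsub>M\<^esub> ?m' \<otimes>\<^bsub>M\<^esub> ?m \<otimes>\<^bsub>M\<^esub> ?m'"
      using c by (simp add: nmD)
    finally show ?case
      using c by (simp flip: M.m_assoc)
  qed (auto simp: psi nmD)
qed

end

locale presentation =
  fixes \<Gamma> :: "'a monoid" and G :: "'g monoid" and \<phi> :: "'a \<Rightarrow> 'g"
    and r :: "('g \<times> 'a) list \<Rightarrow> 'v"
  assumes grA: "group \<Gamma>" and grG: "group G" and hom: "\<phi> \<in> hom \<Gamma> G"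
    and r_eq: "\<And>w v. w \<in> words G \<Gamma> \<Longrightarrow> v \<in> words G \<Gamma> \<Longrightarrow>
           r w = r v \<longleftrightarrow> word_cong \<Gamma> G \<phi> w v"
begin

sublocale I: normal_factor \<Gamma> G \<phi> G \<phi> "\<lambda>x. x" "conj_act G"
  by (rule normal_factor.intro) (rule normal_factorization_id grA grG hom)+

abbreviation "W \<equiv> words G \<Gamma>"
abbreviation cong (infix \<open>\<approx>\<^sub>w\<close> 50) where "w \<approx>\<^sub>w v \<equiv> word_cong \<Gamma> G \<phi> w v"
abbreviation "vl \<equiv> word_eval G \<phi> (conj_act G)"

lemmas L = word_cong_lists[OF _ grA grG hom]

definition s where "s x = (SOME w. w \<in> W \<and> r w = x)"

definition N where
  "N = \<lparr>carrier = r ` W, monoid.mult = (\<lambda>x y. r (s x @ s y)), one = r []\<rparr>"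
definition Nact where "Nact x k = r (word_act G (s x) k)"
definition Nn where "Nn x = vl (s x)"
definition Nc where "Nc a = r [(\<one>\<^bsub>G\<^esub>, a)]"

lemma s: assumes "w \<in> W" shows "s (r w) \<in> W" "s (r w) \<approx>\<^sub>w w"
proof -
  have "s (r w) \<in> W \<and> r (s (r w)) = r w"
    unfolding s_def by (rule someI[where x = w]) (use assms in simp)
  then show "s (r w) \<in> W" "s (r w) \<approx>\<^sub>w w"
    using r_eq assms by auto
qed

lemma act_cong: assumes "w \<approx>\<^sub>w v" "k \<in> carrier G" shows "word_act G w k \<approx>\<^sub>w word_act G v k"
  using assms(1)
proof induction
  case (refl w)
  then show ?case
    using assms(2) by (intro word_cong.refl I.word_act_closed)
next
  case (append u v u' v')
  then show ?case
    by (simp add: word_act_def word_cong.append)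
next
  case (peiffer g h a b)
  have "g \<otimes>\<^bsub>G\<^esub> k \<otimes>\<^bsub>G\<^esub> (inv\<^bsub>G\<^esub> (h \<otimes>\<^bsub>G\<^esub> k) \<otimes>\<^bsub>G\<^esub> \<phi> b \<otimes>\<^bsub>G\<^esub> (h \<otimes>\<^bsub>G\<^esub> k)) =
        g \<otimes>\<^bsub>G\<^esub> (inv\<^bsub>G\<^esub> h \<otimes>\<^bsub>G\<^esub> \<phi> b \<otimes>\<^bsub>G\<^esub> h) \<otimes>\<^bsub>G\<^esub> k"
  proof -
    let ?x = "inv\<^bsub>G\<^esub> h \<otimes>\<^bsub>G\<^esub> (\<phi> b \<otimes>\<^bsub>G\<^esub> (h \<otimes>\<^bsub>G\<^esub> k))"
    have "k \<otimes>\<^bsub>G\<^esub> (inv\<^bsub>G\<^esub> k \<otimes>\<^bsub>G\<^esub> ?x) = ?x"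
      using peiffer assms(2) I.phi by (simp flip: I.B.m_assoc)
    then show ?thesis
      using peiffer assms(2) I.phi by (simp add: I.B.m_assoc I.B.inv_mult_group)
  qed
  with peiffer assms(2) word_cong.peiffer[of "g \<otimes>\<^bsub>G\<^esub> k" G "h \<otimes>\<^bsub>G\<^esub> k" a \<Gamma> b \<phi>] show ?case
    by (simp add: word_act_def)
next
  case (sym v w)
  show ?case by (rule word_cong.sym[OF sym.IH])
next
  case (trans u v w)
  show ?case by (rule word_cong.trans[OF trans.IH])
qed (auto simp: word_act_def assms(2) intro: word_cong.one word_cong.mult)

lemma cong_Cons: "w \<approx>\<^sub>w v \<Longrightarrow> g \<in> carrier G \<Longrightarrow> a \<in> carrier \<Gamma> \<Longrightarrow> (g, a) # w \<approx>\<^sub>w (g, a) # v"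
  using word_cong.append[of \<Gamma> G \<phi> "[(g, a)]" "[(g, a)]" w v] by (simp add: word_cong.refl)

lemma peiffer1:
  "v \<in> W \<Longrightarrow> g \<in> carrier G \<Longrightarrow> a \<in> carrier \<Gamma> \<Longrightarrow> (g, a) # v \<approx>\<^sub>w v @ [(g \<otimes>\<^bsub>G\<^esub> vl v, a)]"
proof (induction v arbitrary: g)
  case Nil
  then show ?case by (simp add: word_cong.refl)
next
  case (Cons x v)
  obtain h b where x: "x = (h, b)" by (cases x)
  let ?k = "inv\<^bsub>G\<^esub> h \<otimes>\<^bsub>G\<^esub> \<phi> b \<otimes>\<^bsub>G\<^esub> h"
  have c: "h \<in> carrier G" "b \<in> carrier \<Gamma>" "v \<in> W" "?k \<in> carrier G" "vl v \<in> carrier G"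
    using Cons.prems x I.phi I.ev_closed by auto
  have "[(g, a), (h, b)] @ v \<approx>\<^sub>w [(h, b), (g \<otimes>\<^bsub>G\<^esub> ?k, a)] @ v"
    using Cons.prems c by (intro word_cong.append word_cong.peiffer word_cong.refl)
  moreover have "[(h, b), (g \<otimes>\<^bsub>G\<^esub> ?k, a)] @ v \<approx>\<^sub>w (h, b) # (v @ [(g \<otimes>\<^bsub>G\<^esub> ?k \<otimes>\<^bsub>G\<^esub> vl v, a)])"
    using Cons.prems c Cons.IH[of "g \<otimes>\<^bsub>G\<^esub> ?k"] by (simp add: cong_Cons)
  ultimately have "[(g, a), (h, b)] @ v \<approx>\<^sub>w (h, b) # (v @ [(g \<otimes>\<^bsub>G\<^esub> ?k \<otimes>\<^bsub>G\<^esub> vl v, a)])"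
    by (rule word_cong.trans)
  moreover have "vl ((h, b) # v) = ?k \<otimes>\<^bsub>G\<^esub> vl v"
    by (simp add: conj_act_def[of G "\<phi> b" h])
  ultimately show ?case
    using Cons.prems c by (simp add: x I.B.m_assoc I.phi del: word_eval.simps)
qed

lemma peiffer: "w \<in> W \<Longrightarrow> v \<in> W \<Longrightarrow> w @ v \<approx>\<^sub>w v @ word_act G w (vl v)"
proof (induction w)
  case Nil
  then show ?case by (simp add: word_act_def word_cong.refl)
next
  case (Cons x w)
  obtain g a where x: "x = (g, a)" by (cases x)
  have c: "g \<in> carrier G" "a \<in> carrier \<Gamma>" "w \<in> W" "vl v \<in> carrier G"
    using Cons.prems x I.ev_closed by auto
  have "(g, a) # (w @ v) \<approx>\<^sub>w ((g, a) # v) @ word_act G w (vl v)"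
    using Cons c by (simp add: cong_Cons)
  moreover have "((g, a) # v) @ word_act G w (vl v) \<approx>\<^sub>w (v @ [(g \<otimes>\<^bsub>G\<^esub> vl v, a)]) @ word_act G w (vl v)"
    using Cons.prems c I.word_act_closed[OF \<open>w \<in> W\<close>]
    by (intro word_cong.append peiffer1 word_cong.refl) auto
  ultimately have "(g, a) # (w @ v) \<approx>\<^sub>w (v @ [(g \<otimes>\<^bsub>G\<^esub> vl v, a)]) @ word_act G w (vl v)"
    by (rule word_cong.trans)
  then show ?case
    by (simp add: x word_act_def)
qed

lemma left_inv: "w \<in> W \<Longrightarrow> \<exists>v\<in>W. v @ w \<approx>\<^sub>w []"
proof (induction w)
  case Nil
  then show ?case by (intro bexI[of _ "[]"]) (auto intro: word_cong.refl)
next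
  case (Cons x w)
  obtain g a where x: "x = (g, a)" by (cases x)
  have c: "g \<in> carrier G" "a \<in> carrier \<Gamma>" "w \<in> W"
    using Cons.prems x by auto
  obtain v where v: "v \<in> W" "v @ w \<approx>\<^sub>w []" using Cons by auto
  have "[(g, inv\<^bsub>\<Gamma>\<^esub> a), (g, a)] \<approx>\<^sub>w [(g, \<one>\<^bsub>\<Gamma>\<^esub>)]"
    using c word_cong.mult[of g G "inv\<^bsub>\<Gamma>\<^esub> a" \<Gamma> a \<phi>] by simp
  then have "[(g, inv\<^bsub>\<Gamma>\<^esub> a), (g, a)] \<approx>\<^sub>w []"
    by (rule word_cong.trans) (rule word_cong.one[OF c(1)])
  then have "v @ [(g, inv\<^bsub>\<Gamma>\<^esub> a), (g, a)] @ w \<approx>\<^sub>w v @ [] @ w"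
    using v c by (intro word_cong.append word_cong.refl)
  also have "v @ [] @ w = v @ w" by simp
  finally have "v @ [(g, inv\<^bsub>\<Gamma>\<^esub> a), (g, a)] @ w \<approx>\<^sub>w []"
    using v(2) by (rule word_cong.trans)
  then have "(v @ [(g, inv\<^bsub>\<Gamma>\<^esub> a)]) @ x # w \<approx>\<^sub>w []"
    by (simp add: x)
  then show ?case
    using v c by (intro bexI[of _ "v @ [(g, inv\<^bsub>\<Gamma>\<^esub> a)]"]) auto
qed

lemma r_cong: "w \<approx>\<^sub>w v \<Longrightarrow> r w = r v"
  using r_eq L by blast

lemma N_mult: "w \<in> W \<Longrightarrow> v \<in> W \<Longrightarrow> r w \<otimes>\<^bsub>N\<^esub> r v = r (w @ v)"
  by (auto simp: N_def intro!: r_cong word_cong.append s)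

lemma N_simps: "carrier N = r ` W" "\<one>\<^bsub>N\<^esub> = r []"
  by (simp_all add: N_def)

lemma N_act: "w \<in> W \<Longrightarrow> k \<in> carrier G \<Longrightarrow> Nact (r w) k = r (word_act G w k)"
  by (auto simp: Nact_def intro!: r_cong act_cong s)

lemma N_n: "w \<in> W \<Longrightarrow> Nn (r w) = vl w"
  by (auto simp: Nn_def intro!: I.ev_cong s)

lemma N_group: "group N"
proof (rule groupI)
  fix x assume "x \<in> carrier N"
  then obtain w where w: "w \<in> W" "x = r w" by (auto simp: N_simps)
  then obtain v where "v \<in> W" "v @ w \<approx>\<^sub>w []" using left_inv by blast
  then show "\<exists>y\<in>carrier N. y \<otimes>\<^bsub>N\<^esub> x = \<one>\<^bsub>N\<^esub>"
    using w by (intro bexI[of _ "r v"]) (auto simp: N_mult r_cong N_simps)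
qed (fastforce simp: N_mult N_simps)+

lemma word_act_mult:
  "w \<in> W \<Longrightarrow> g \<in> carrier G \<Longrightarrow> h \<in> carrier G \<Longrightarrow>
    word_act G w (g \<otimes>\<^bsub>G\<^esub> h) = word_act G (word_act G w g) h"
  by (induction w) (auto simp: word_act_def I.B.m_assoc)

lemma word_act_one: "w \<in> W \<Longrightarrow> word_act G w \<one>\<^bsub>G\<^esub> = w"
  by (induction w) (auto simp: word_act_def)

lemma N_normal_map: "normal_map N G Nn Nact"
proof -
  interpret N: group N by (rule N_group)
  have "right_action_by_automorphisms N G Nact"
  proof (rule right_action_by_automorphismsI)
    fix m m' g assume "m \<in> carrier N" "m' \<in> carrier N" and g: "g \<in> carrier G"
    then obtain w w' where w: "w \<in> W" "m = r w" "w' \<in> W" "m' = r w'" by (auto simp: N_simps)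
    moreover have "word_act G (w @ w') g = word_act G w g @ word_act G w' g"
      by (simp add: word_act_def)
    moreover have "word_act G w g \<in> W" "word_act G w' g \<in> W"
      using w g I.word_act_closed by auto
    moreover have "w @ w' \<in> W"
      using w by auto
    ultimately show "Nact (m \<otimes>\<^bsub>N\<^esub> m') g = Nact m g \<otimes>\<^bsub>N\<^esub> Nact m' g"
      using g by (simp only: N_mult N_act)
  qed (use I.word_act_closed in \<open>auto simp: N_simps N_act word_act_one word_act_mult grG\<close>)
  moreover have "Nn \<in> hom N G"
  proof (rule homI)
    fix x y assume "x \<in> carrier N" "y \<in> carrier N"
    then obtain w v where w: "w \<in> W" "x = r w" "v \<in> W" "y = r v" by (auto simp: N_simps)
    moreover have "w @ v \<in> W" using w by auto
    ultimately show "Nn (x \<otimes>\<^bsub>N\<^esub> y) = Nn x \<otimes>\<^bsub>G\<^esub> Nn y"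
      by (simp only: N_mult N_n I.ev_append)
  qed (auto simp: N_simps N_n I.ev_closed)
  moreover have "Nn (Nact m g) = inv\<^bsub>G\<^esub> g \<otimes>\<^bsub>G\<^esub> Nn m \<otimes>\<^bsub>G\<^esub> g"
    if "m \<in> carrier N" "g \<in> carrier G" for m g
    using that I.word_act_closed by (auto simp: N_simps N_act N_n I.ev_word_act conj_act_def)
  moreover have "Nact m (Nn m') = inv\<^bsub>N\<^esub> m' \<otimes>\<^bsub>N\<^esub> m \<otimes>\<^bsub>N\<^esub> m'"
    if m: "m \<in> carrier N" "m' \<in> carrier N" for m m'
  proof -
    obtain w v where w: "w \<in> W" "m = r w" "v \<in> W" "m' = r v" using m by (auto simp: N_simps)
    have c: "word_act G w (vl v) \<in> W" using w I.word_act_closed I.ev_closed by blast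
    have "m \<otimes>\<^bsub>N\<^esub> m' = m' \<otimes>\<^bsub>N\<^esub> Nact m (Nn m')"
      using w c r_cong[OF peiffer[of w v]] by (simp add: N_mult N_n N_act I.ev_closed)
    moreover have "Nact m (Nn m') \<in> carrier N"
      using w c by (auto simp: N_n N_act N_simps I.ev_closed)
    ultimately show ?thesis
      using m by (simp add: N.m_assoc N.inv_solve_left)
  qed
  ultimately show ?thesis
    using N_group grG by (simp add: normal_map_def)
qed

lemma N_c_word: "g \<in> carrier G \<Longrightarrow> a \<in> carrier \<Gamma> \<Longrightarrow> Nact (Nc a) g = r [(g, a)]"
  by (simp add: Nc_def N_act word_act_def)

lemma N_factorization: "normal_factorization \<Gamma> G \<phi> N Nc Nn Nact"
proof -
  have "Nc \<in> hom \<Gamma> N"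
    using word_cong.mult[of "\<one>\<^bsub>G\<^esub>" G _ \<Gamma> _ \<phi>]
    by (auto simp: hom_def Nc_def N_mult N_simps intro: r_cong[symmetric])
  moreover have "Nn (Nc a) = \<phi> a" if "a \<in> carrier \<Gamma>" for a
    using that I.phi by (simp add: Nc_def N_n conj_act_def)
  ultimately show ?thesis
    by (simp add: normal_factorization_def N_normal_map)
qed

lemma N_universal: "is_normal_closure TYPE('m) \<Gamma> G \<phi> N Nc Nn Nact"
  unfolding is_normal_closure_def
proof (intro conjI allI impI)
  show "normal_factorization \<Gamma> G \<phi> N Nc Nn Nact" by (rule N_factorization)
  fix M :: "'m monoid" and \<psi> n' act'
  assume "normal_factorization \<Gamma> G \<phi> M \<psi> n' act'"
  then interpret F: normal_factor \<Gamma> G \<phi> M \<psi> n' act'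
    by (intro normal_factor.intro grA)
  define u where "u = (\<lambda>x\<in>carrier N. F.ev (s x))"
  have u: "u (r w) = F.ev w" if "w \<in> W" for w
    using that s[OF that] F.ev_cong by (simp add: u_def N_simps)
  let ?P = "\<lambda>u. u \<in> extensional (carrier N) \<and> normal_morphism G N Nn Nact M n' act' u \<and>
        (\<forall>\<gamma>\<in>carrier \<Gamma>. u (Nc \<gamma>) = \<psi> \<gamma>)"
  show "\<exists>!u. ?P u"
  proof (rule ex1I)
    have "u \<in> hom N M"
    proof (rule homI)
      fix x y assume "x \<in> carrier N" "y \<in> carrier N"
      then obtain w v where w: "w \<in> W" "x = r w" "v \<in> W" "y = r v" by (auto simp: N_simps)
      moreover have "w @ v \<in> W" using w by auto
      ultimately show "u (x \<otimes>\<^bsub>N\<^esub> y) = u x \<otimes>\<^bsub>M\<^esub> u y"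
        by (simp only: N_mult u F.ev_append)
    qed (auto simp: N_simps u F.ev_closed)
    moreover have "u \<in> extensional (carrier N)"
      by (simp add: u_def)
    moreover have "u (Nc \<gamma>) = \<psi> \<gamma>" if "\<gamma> \<in> carrier \<Gamma>" for \<gamma>
      using that by (simp add: Nc_def u F.psi F.nmD)
    moreover have "n' (u m) = Nn m" if "m \<in> carrier N" for m
      using that by (auto simp: N_simps u N_n F.n_ev)
    moreover have "u (Nact m g) = act' (u m) g" if "m \<in> carrier N" "g \<in> carrier G" for m g
      using that I.word_act_closed by (auto simp: N_simps u N_act F.ev_word_act)
    ultimately show "?P u"
      by (simp add: normal_morphism_def)
  next
    fix v assume v: "?P v"
    have vh: "v \<in> hom N M" using v by (simp add: normal_morphism_def)
    have "v (r w) = F.ev w" if "w \<in> W" for w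
      using that
    proof (induction w)
      case Nil
      then show ?case
        using hom_one[OF vh N_group F.M.is_group] by (simp add: N_simps)
    next
      case (Cons x w)
      obtain g a where x: "x = (g, a)" by (cases x)
      have c: "g \<in> carrier G" "a \<in> carrier \<Gamma>" "w \<in> W"
        using Cons.prems x by auto
      have "v (r (x # w)) = v (r [(g, a)] \<otimes>\<^bsub>N\<^esub> r w)"
        using c by (simp add: x N_mult)
      also have "\<dots> = v (r [(g, a)]) \<otimes>\<^bsub>M\<^esub> v (r w)"
        using c by (intro hom_mult[OF vh]) (auto simp: N_simps)
      also have "r [(g, a)] = Nact (Nc a) g"
        using c by (simp add: N_c_word)
      also have "v (Nact (Nc a) g) = act' (\<psi> a) g"
      proof -
        have "Nc a \<in> carrier N" using c by (auto simp: Nc_def N_simps)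
        then show ?thesis using v c by (simp add: normal_morphism_def)
      qed
      finally show ?case using Cons.IH c by (simp add: x)
    qed
    then show "v = u"
      using v u by (intro extensionalityI[of v "carrier N" u]) (auto simp: u_def N_simps)
  qed
qed

end

lemma normal_closure_exists:
  fixes \<Gamma> :: "'a monoid" and G :: "('a, 'b) stage monoid" and \<phi> :: "'a \<Rightarrow> ('a, 'b) stage"
  assumes "group \<Gamma>" "group G" "\<phi> \<in> hom \<Gamma> G"
  obtains N :: "('a, 'b) stage monoid" and c n act
  where "is_normal_closure TYPE(('a, 'b) stage) \<Gamma> G \<phi> N c n act"
    and "is_normal_closure TYPE('m) \<Gamma> G \<phi> N c n act"
proof -
  define r where "r w = Word (SOME v. word_cong \<Gamma> G \<phi> w v)" for w
  interpret presentation \<Gamma> G \<phi> r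
  proof (rule presentation.intro)
    fix w v assume wv: "w \<in> words G \<Gamma>" "v \<in> words G \<Gamma>"
    let ?C = "word_cong \<Gamma> G \<phi>"
    show "r w = r v \<longleftrightarrow> ?C w v"
    proof
      assume "?C w v"
      then have "?C w = ?C v" by (intro ext) (blast intro: word_cong.sym word_cong.trans)
      then show "r w = r v" by (simp add: r_def)
    next
      assume "r w = r v"
      moreover have "?C w (SOME x. ?C w x)" "?C v (SOME x. ?C v x)"
        using wv by (auto intro: someI word_cong.refl)
      ultimately show "?C w v"
        unfolding r_def by (metis stage.inject(2) word_cong.sym word_cong.trans)
    qed
  qed (use assms in auto)
  show thesis
    by (rule that) (rule N_universal)+
qed

lemma normal_morphism_comp:
  assumes "normal_morphism G N n act M n' act' u" "normal_morphism G M n' act' K n'' act'' v"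
    and "normal_map N G n act"
  shows "normal_morphism G N n act K n'' act'' (restrict (v \<circ> u) (carrier N))"
proof -
  interpret N: group N using assms(3) by (rule normal_mapD)
  have u: "u \<in> hom N M" and v: "v \<in> hom M K"
    using assms by (auto simp: normal_morphism_def)
  have "restrict (v \<circ> u) (carrier N) \<in> hom N K"
    using u v by (auto simp: hom_def Pi_def)
  moreover have "u m \<in> carrier M" if "m \<in> carrier N" for m
    using u that by (rule hom_in_carrier)
  ultimately show ?thesis
    using assms(1,2) normal_mapD(7)[OF assms(3)] by (simp add: normal_morphism_def)
qed

lemma is_normal_closure_transfer:
  fixes N P :: "'n monoid" and \<Gamma> :: "'a monoid" and G :: "'g monoid"
  assumes P: "is_normal_closure TYPE('n) \<Gamma> G \<phi> P c n act"
    and Q: "is_normal_closure TYPE('n) \<Gamma> G \<phi> N c' n' act'"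
    and R: "is_normal_closure TYPE('m) \<Gamma> G \<phi> N c' n' act'"
  shows "is_normal_closure TYPE('m) \<Gamma> G \<phi> P c n act"
proof -
  have facP: "normal_factorization \<Gamma> G \<phi> P c n act"
    and facN: "normal_factorization \<Gamma> G \<phi> N c' n' act'"
    using P Q by (auto simp: is_normal_closure_def)
  then have nmP: "normal_map P G n act" and nmN: "normal_map N G n' act'"
    and c: "\<And>\<gamma>. \<gamma> \<in> carrier \<Gamma> \<Longrightarrow> c \<gamma> \<in> carrier P"
    and c': "\<And>\<gamma>. \<gamma> \<in> carrier \<Gamma> \<Longrightarrow> c' \<gamma> \<in> carrier N"
    by (auto simp: normal_factorization_def hom_def)
  obtain u where u: "normal_morphism G P n act N n' act' u" "\<And>\<gamma>. \<gamma> \<in> carrier \<Gamma> \<Longrightarrow> u (c \<gamma>) = c' \<gamma>"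
    using P facN unfolding is_normal_closure_def by blast
  obtain v where v: "normal_morphism G N n' act' P n act v" "\<And>\<gamma>. \<gamma> \<in> carrier \<Gamma> \<Longrightarrow> v (c' \<gamma>) = c \<gamma>"
    using Q facP unfolding is_normal_closure_def by blast
  have uP: "u x \<in> carrier N" if "x \<in> carrier P" for x
    using u(1) that by (auto simp: normal_morphism_def dest: hom_in_carrier)
  have vN: "v x \<in> carrier P" if "x \<in> carrier N" for x
    using v(1) that by (auto simp: normal_morphism_def dest: hom_in_carrier)
  have idP: "normal_morphism G P n act P n act (restrict (\<lambda>x. x) (carrier P))"
    using normal_mapD[OF nmP] group.is_monoid[of P]
    by (auto simp: normal_morphism_def hom_def monoid.m_closed)
  have vu_id: "restrict (v \<circ> u) (carrier P) = restrict (\<lambda>x. x) (carrier P)"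
  proof -
    let ?id = "restrict (\<lambda>x. x) (carrier P)" and ?vu = "restrict (v \<circ> u) (carrier P)"
    let ?P = "\<lambda>w. w \<in> extensional (carrier P) \<and> normal_morphism G P n act P n act w \<and>
           (\<forall>\<gamma>\<in>carrier \<Gamma>. w (c \<gamma>) = c \<gamma>)"
    have "\<exists>!w. ?P w"
      using P facP unfolding is_normal_closure_def by blast
    moreover have "?P ?vu"
      using normal_morphism_comp[OF u(1) v(1) nmP] u(2) v(2) c by simp
    moreover have "?P ?id"
      using idP c by simp
    ultimately show "?vu = ?id" by blast
  qed
  have vu: "v (u x) = x" if "x \<in> carrier P" for x
    using that fun_cong[OF vu_id, of x] by simp
  show ?thesis
    unfolding is_normal_closure_def
  proof (intro conjI allI impI)
    show "normal_factorization \<Gamma> G \<phi> P c n act" by (rule facP)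
    fix M :: "'m monoid" and \<psi> k b
    assume M: "normal_factorization \<Gamma> G \<phi> M \<psi> k b"
    then have "\<exists>!f. f \<in> extensional (carrier N) \<and> normal_morphism G N n' act' M k b f \<and>
           (\<forall>\<gamma>\<in>carrier \<Gamma>. f (c' \<gamma>) = \<psi> \<gamma>)"
      using R unfolding is_normal_closure_def by blast
    then obtain f where f: "normal_morphism G N n' act' M k b f"
        "\<And>\<gamma>. \<gamma> \<in> carrier \<Gamma> \<Longrightarrow> f (c' \<gamma>) = \<psi> \<gamma>"
      and uniq: "\<And>f'. f' \<in> extensional (carrier N) \<Longrightarrow> normal_morphism G N n' act' M k b f' \<Longrightarrow>
        (\<And>\<gamma>. \<gamma> \<in> carrier \<Gamma> \<Longrightarrow> f' (c' \<gamma>) = \<psi> \<gamma>) \<Longrightarrow> f' = f"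
      by (elim ex1E) blast
    show "\<exists>!w. w \<in> extensional (carrier P) \<and> normal_morphism G P n act M k b w \<and>
            (\<forall>\<gamma>\<in>carrier \<Gamma>. w (c \<gamma>) = \<psi> \<gamma>)"
    proof (rule ex1I[where a = "restrict (f \<circ> u) (carrier P)"])
      show "restrict (f \<circ> u) (carrier P) \<in> extensional (carrier P) \<and>
          normal_morphism G P n act M k b (restrict (f \<circ> u) (carrier P)) \<and>
          (\<forall>\<gamma>\<in>carrier \<Gamma>. restrict (f \<circ> u) (carrier P) (c \<gamma>) = \<psi> \<gamma>)"
        using normal_morphism_comp[OF u(1) f(1) nmP] u f c by simp
    next
      fix w assume w: "w \<in> extensional (carrier P) \<and> normal_morphism G P n act M k b w \<and>
            (\<forall>\<gamma>\<in>carrier \<Gamma>. w (c \<gamma>) = \<psi> \<gamma>)"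
      have wv: "restrict (w \<circ> v) (carrier N) = f"
      proof (rule uniq)
        show "normal_morphism G N n' act' M k b (restrict (w \<circ> v) (carrier N))"
          using w by (intro normal_morphism_comp[OF v(1) _ nmN]) simp
      qed (use w v c' in simp_all)
      have "w (v y) = f y" if "y \<in> carrier N" for y
        using that fun_cong[OF wv, of y] by simp
      from this[OF uP] show "w = restrict (f \<circ> u) (carrier P)"
        using w by (intro extensionalityI[of w "carrier P"]) (simp_all add: vu)
    qed
  qed
qed

theorem normal_closure_universal:
  fixes \<Gamma> :: "'a monoid" and G :: "('a, 'b) stage monoid" and \<phi> :: "'a \<Rightarrow> ('a, 'b) stage"
  assumes "group \<Gamma>" "group G" "\<phi> \<in> hom \<Gamma> G"
  shows "is_normal_closure TYPE('m) \<Gamma> G \<phi> (closure_group \<Gamma> G \<phi>) (closure_map \<Gamma> G \<phi>)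
           (closure_normal_map \<Gamma> G \<phi>) (closure_action \<Gamma> G \<phi>)"
proof -
  obtain N :: "('a, 'b) stage monoid" and c n act where
    N: "is_normal_closure TYPE(('a, 'b) stage) \<Gamma> G \<phi> N c n act"
    and M: "is_normal_closure TYPE('m) \<Gamma> G \<phi> N c n act"
    using normal_closure_exists[OF assms, where 'm = 'm] by blast
  let ?P = "\<lambda>(N, c, n, act). is_normal_closure TYPE(('a, 'b) stage) \<Gamma> G \<phi> N c n act"
  have "?P (normal_closure \<Gamma> G \<phi>)"
    unfolding normal_closure_def by (rule someI[of ?P "(N, c, n, act)"]) (simp add: N)
  then have "is_normal_closure TYPE(('a, 'b) stage) \<Gamma> G \<phi> (closure_group \<Gamma> G \<phi>) (closure_map \<Gamma> G \<phi>)
           (closure_normal_map \<Gamma> G \<phi>) (closure_action \<Gamma> G \<phi>)"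
    by (simp add: case_prod_unfold closure_group_def closure_map_def closure_normal_map_def
        closure_action_def)
  then show ?thesis
    using is_normal_closure_transfer N M by blast
qed

lemma tower_simps:
  "tower_group \<Gamma> G \<phi> 0 = base_group G"
  "tower_map \<Gamma> G \<phi> 0 = Base \<circ> \<phi>"
  "tower_group \<Gamma> G \<phi> (Suc i) = closure_group \<Gamma> (tower_group \<Gamma> G \<phi> i) (tower_map \<Gamma> G \<phi> i)"
  "tower_map \<Gamma> G \<phi> (Suc i) = closure_map \<Gamma> (tower_group \<Gamma> G \<phi> i) (tower_map \<Gamma> G \<phi> i)"
  by (simp_all add: tower_group_def tower_map_def case_prod_unfold)

lemma Base_iso:
  assumes "group G"
  shows "group (base_group G :: ('a, 'b) stage monoid)"
    and "(Base :: 'b \<Rightarrow> ('a, 'b) stage) \<in> iso G (base_group G)"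
proof -
  have inj: "inj (Base :: 'b \<Rightarrow> ('a, 'b) stage)" by (simp add: inj_def)
  interpret group G by fact
  show "group (base_group G :: ('a, 'b) stage monoid)"
    by (rule groupI)
      (use l_inv_ex in \<open>auto simp: base_group_def the_inv_f_f[OF inj] m_assoc\<close>)
  show "(Base :: 'b \<Rightarrow> ('a, 'b) stage) \<in> iso G (base_group G)"
    using inj by (auto simp: iso_def hom_def base_group_def the_inv_f_f[OF inj] bij_betw_def inj_on_def)
qed

lemma tower_stage:
  fixes \<Gamma> :: "'a monoid" and G :: "'b monoid" and \<phi> :: "'a \<Rightarrow> 'b"
  assumes "group \<Gamma>" "group G" "\<phi> \<in> hom \<Gamma> G"
  shows "group (tower_group \<Gamma> G \<phi> i)"
    and "tower_map \<Gamma> G \<phi> i \<in> hom \<Gamma> (tower_group \<Gamma> G \<phi> i)"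
proof -
  have "group (tower_group \<Gamma> G \<phi> i) \<and> tower_map \<Gamma> G \<phi> i \<in> hom \<Gamma> (tower_group \<Gamma> G \<phi> i)"
  proof (induction i)
    case 0
    have Base: "(Base :: 'b \<Rightarrow> ('a, 'b) stage) \<in> hom G (base_group G)"
      using Base_iso(2)[OF assms(2), where 'a = 'a] by (simp add: iso_def)
    show ?case
      using Base_iso(1)[OF assms(2), where 'a = 'a] hom_compose[OF assms(3) Base]
      by (simp add: tower_simps o_def)
  next
    case (Suc i)
    then show ?case
      using normal_closure_universal[OF assms(1), of "tower_group \<Gamma> G \<phi> i" "tower_map \<Gamma> G \<phi> i"]
      unfolding is_normal_closure_def normal_factorization_def normal_map_def tower_simps by blast
  qed
  then show "group (tower_group \<Gamma> G \<phi> i)" "tower_map \<Gamma> G \<phi> i \<in> hom \<Gamma> (tower_group \<Gamma> G \<phi> i)"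
    by auto
qed

theorem tower_is_normal_closure:
  fixes \<Gamma> :: "'a monoid" and G :: "'b monoid" and \<phi> :: "'a \<Rightarrow> 'b"
  assumes "group \<Gamma>" "group G" "\<phi> \<in> hom \<Gamma> G"
  shows "is_normal_closure TYPE('m) \<Gamma> (tower_group \<Gamma> G \<phi> i) (tower_map \<Gamma> G \<phi> i)
           (tower_group \<Gamma> G \<phi> (Suc i)) (tower_map \<Gamma> G \<phi> (Suc i))
           (tower_normal_map \<Gamma> G \<phi> i) (tower_action \<Gamma> G \<phi> i)"
  unfolding tower_simps tower_normal_map_def tower_action_def
  by (rule normal_closure_universal[OF assms(1) tower_stage[OF assms]])

end

theory Submission
  imports Defs
begin

text \<open>
  Write \<open>\<gamma>\<^sub>i\<close> for the terms of the lower central series, starting with \<open>\<gamma>\<^sub>0(G) = G\<close>, and \<open>\<Gamma>\<^sub>i\<close> for the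
  stages of the tower, also numbered from \<open>0\<close>. The proof has two independent halves.

  Injectivity. The stage \<open>\<Gamma>\<^sub>i\<close> maps to \<open>\<Gamma> / \<gamma>\<^sub>i(\<Gamma>)\<close> compatibly with the maps from \<open>\<Gamma>\<close>
  (\<open>tower_to_lower_central_quotient\<close>): the quotients \<open>\<Gamma> / \<gamma>\<^sub>i(\<Gamma>)\<close> form the tower of the homomorphism from
  \<open>\<Gamma>\<close> to the trivial group, to which every other tower maps. The step from \<open>i\<close> to \<open>i + 1\<close> uses that
  \<open>\<Gamma> / \<gamma>\<^sub>i\<^sub>+\<^sub>1(\<Gamma>)\<close> is a central extension of \<open>\<Gamma> / \<gamma>\<^sub>i(\<Gamma>)\<close>. Its pullback along \<open>\<Gamma>\<^sub>i \<rightarrow> \<Gamma> / \<gamma>\<^sub>i(\<Gamma>)\<close> is a central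
  extension of \<open>\<Gamma>\<^sub>i\<close>, hence a normal map, so that the universal property of \<open>\<Gamma>\<^sub>i\<^sub>+\<^sub>1\<close> applies to it. When
  \<open>\<gamma>\<^sub>k(\<Gamma>)\<close> is trivial, the maps \<open>\<Gamma> \<rightarrow> \<Gamma>\<^sub>i\<close> with \<open>i \<ge> k\<close> are therefore injective.

  Surjectivity. The image of \<open>\<Gamma>\<^sub>i\<^sub>+\<^sub>1\<close> in \<open>\<Gamma>\<^sub>i\<close> lies in the normal closure of the image \<open>H\<close> of \<open>\<Gamma>\<close>;
  inductively the image of \<open>\<Gamma>\<^sub>i\<^sub>+\<^sub>j\<close> lies in the \<open>j\<close>-fold iterated normal closure of \<open>H\<close> in \<open>\<Gamma>\<^sub>i\<close>
  (\<open>normal_closure_image_iterated\<close>). As normal maps have central kernels, every \<open>\<Gamma>\<^sub>i\<close> is nilpotent,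
  and in a nilpotent group each subgroup \<open>H\<close> is subnormal: its iterated normal closures descend to
  \<open>H\<close> after finitely many steps (\<open>iterated_normal_closure_nilpotent\<close>). So every coordinate of a
  point of the limit comes from \<open>\<Gamma>\<close>, and by injectivity at the stages \<open>i \<ge> k\<close> all coordinates come
  from the same element.
\<close>

section \<open>The lower central series\<close>

declare lower_central.simps(2) [simp del]

lemma lower_central_normal:
  assumes "group G"
  shows "lower_central G k \<lhd> G"
proof -
  interpret group G by fact
  show ?thesis
  proof (induction k)
    case 0
    show ?case
      by (auto intro: normal_invI subgroup_self)
  next
    case (Suc k)
    then interpret L: normal "lower_central G k" G .
    show ?case
      unfolding lower_central.simps
    proof (rule normal_generateI)
      fix h g
      assume "h \<in> (\<Union>x\<in>lower_central G k. \<Union>y\<in>carrier G. {x \<otimes>\<^bsub>G\<^esub> y \<otimes>\<^bsub>G\<^esub> inv\<^bsub>G\<^esub> x \<otimes>\<^bsub>G\<^esub> inv\<^bsub>G\<^esub> y})"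
        and g: "g \<in> carrier G"
      then obtain x y where x: "x \<in> lower_central G k" and y: "y \<in> carrier G"
        and h: "h = x \<otimes>\<^bsub>G\<^esub> y \<otimes>\<^bsub>G\<^esub> inv\<^bsub>G\<^esub> x \<otimes>\<^bsub>G\<^esub> inv\<^bsub>G\<^esub> y"
        by blast
      let ?x = "g \<otimes>\<^bsub>G\<^esub> x \<otimes>\<^bsub>G\<^esub> inv\<^bsub>G\<^esub> g" and ?y = "g \<otimes>\<^bsub>G\<^esub> y \<otimes>\<^bsub>G\<^esub> inv\<^bsub>G\<^esub> g"
      have cancel: "inv\<^bsub>G\<^esub> g \<otimes>\<^bsub>G\<^esub> (g \<otimes>\<^bsub>G\<^esub> z) = z" if "z \<in> carrier G" for z
        using that g by (simp flip: m_assoc)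
      have "g \<otimes>\<^bsub>G\<^esub> h \<otimes>\<^bsub>G\<^esub> inv\<^bsub>G\<^esub> g = ?x \<otimes>\<^bsub>G\<^esub> ?y \<otimes>\<^bsub>G\<^esub> inv\<^bsub>G\<^esub> ?x \<otimes>\<^bsub>G\<^esub> inv\<^bsub>G\<^esub> ?y"
        using x y g L.mem_carrier[OF x] by (simp add: h m_assoc inv_mult_group cancel)
      moreover have "?x \<in> lower_central G k" "?y \<in> carrier G"
        using x y g by (simp_all add: L.inv_op_closed2)
      ultimately show "g \<otimes>\<^bsub>G\<^esub> h \<otimes>\<^bsub>G\<^esub> inv\<^bsub>G\<^esub> g
          \<in> (\<Union>x\<in>lower_central G k. \<Union>y\<in>carrier G. {x \<otimes>\<^bsub>G\<^esub> y \<otimes>\<^bsub>G\<^esub> inv\<^bsub>G\<^esub> x \<otimes>\<^bsub>G\<^esub> inv\<^bsub>G\<^esub> y})"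
        by blast
    qed (auto dest: L.mem_carrier)
  qed
qed

lemma lower_central_subgroup:
  "group G \<Longrightarrow> subgroup (lower_central G k) G"
  using lower_central_normal normal_imp_subgroup by blast

lemma commutator_in_lower_central:
  assumes "x \<in> lower_central G k" "y \<in> carrier G"
  shows "x \<otimes>\<^bsub>G\<^esub> y \<otimes>\<^bsub>G\<^esub> inv\<^bsub>G\<^esub> x \<otimes>\<^bsub>G\<^esub> inv\<^bsub>G\<^esub> y \<in> lower_central G (Suc k)"
  using assms by (auto simp: lower_central.simps(2) intro: generate.incl)

lemma lower_central_Suc_subset:
  assumes "group G"
  shows "lower_central G (Suc k) \<subseteq> lower_central G k"
proof -
  interpret group G by fact
  interpret L: normal "lower_central G k" G using assms by (rule lower_central_normal)
  have "x \<otimes>\<^bsub>G\<^esub> y \<otimes>\<^bsub>G\<^esub> inv\<^bsub>G\<^esub> x \<otimes>\<^bsub>G\<^esub> inv\<^bsub>G\<^esub> y \<in> lower_central G k"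
    if x: "x \<in> lower_central G k" and y: "y \<in> carrier G" for x y
  proof -
    have "x \<otimes>\<^bsub>G\<^esub> (y \<otimes>\<^bsub>G\<^esub> inv\<^bsub>G\<^esub> x \<otimes>\<^bsub>G\<^esub> inv\<^bsub>G\<^esub> y) \<in> lower_central G k"
      using x y by (intro L.m_closed L.inv_op_closed2 L.m_inv_closed)
    then show ?thesis
      using y L.mem_carrier[OF x] by (simp add: m_assoc)
  qed
  then show ?thesis
    unfolding lower_central.simps by (intro generate_subgroup_incl L.subgroup_axioms) auto
qed

lemma lower_central_hom_image:
  assumes "group G" "group G'" "f \<in> hom G G'"
  shows "f ` lower_central G k \<subseteq> lower_central G' k"
proof (induction k)
  case 0
  show ?case using assms(3) by (auto simp: hom_def)
next
  case (Suc k)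
  interpret group_hom G G' f
    using assms by (simp add: group_hom_def group_hom_axioms_def)
  have sub: "lower_central G k \<subseteq> carrier G"
    using lower_central_subgroup[OF assms(1)] by (rule subgroup.subset)
  let ?C = "\<Union>x\<in>lower_central G k. \<Union>y\<in>carrier G. {x \<otimes>\<^bsub>G\<^esub> y \<otimes>\<^bsub>G\<^esub> inv\<^bsub>G\<^esub> x \<otimes>\<^bsub>G\<^esub> inv\<^bsub>G\<^esub> y}"
  have "f ` ?C \<subseteq> lower_central G' (Suc k)"
  proof -
    have "f (x \<otimes>\<^bsub>G\<^esub> y \<otimes>\<^bsub>G\<^esub> inv\<^bsub>G\<^esub> x \<otimes>\<^bsub>G\<^esub> inv\<^bsub>G\<^esub> y) \<in> lower_central G' (Suc k)"
      if "x \<in> lower_central G k" "y \<in> carrier G" for x y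
      using that sub Suc.IH commutator_in_lower_central[of "f x" G' k "f y"]
      by (simp add: subset_iff image_subset_iff)
    then show ?thesis by auto
  qed
  then have "generate G' (f ` ?C) \<subseteq> lower_central G' (Suc k)"
    by (intro H.generate_subgroup_incl lower_central_subgroup assms)
  moreover have "?C \<subseteq> carrier G" using sub by auto
  ultimately show ?case
    by (simp add: generate_img lower_central.simps(2))
qed

text \<open>
  If \<open>lower_central G k\<close> is trivial then \<open>f\<close> kills \<open>lower_central M k\<close>. This term is then central,
  so the next one is trivial.
\<close>
lemma nilpotent_group_if_central_kernel:
  assumes "group M" "nilpotent_group G" "f \<in> hom M G"
    and central: "\<And>x y. x \<in> carrier M \<Longrightarrow> y \<in> carrier M \<Longrightarrow> f x = \<one>\<^bsub>G\<^esub> \<Longrightarrow>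
      x \<otimes>\<^bsub>M\<^esub> y = y \<otimes>\<^bsub>M\<^esub> x"
  shows "nilpotent_group M"
proof -
  interpret group M by fact
  obtain k where G: "group G" and k: "lower_central G k = {\<one>\<^bsub>G\<^esub>}"
    using assms(2) by (auto simp: nilpotent_group_def)
  have sub: "lower_central M k \<subseteq> carrier M"
    using lower_central_subgroup[OF assms(1)] by (rule subgroup.subset)
  have "x \<otimes>\<^bsub>M\<^esub> y \<otimes>\<^bsub>M\<^esub> inv\<^bsub>M\<^esub> x \<otimes>\<^bsub>M\<^esub> inv\<^bsub>M\<^esub> y = \<one>\<^bsub>M\<^esub>"
    if x: "x \<in> lower_central M k" and y: "y \<in> carrier M" for x y
  proof -
    have "f x = \<one>\<^bsub>G\<^esub>"
      using lower_central_hom_image[OF assms(1) G assms(3), of k] x k by auto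
    then have "x \<otimes>\<^bsub>M\<^esub> y = y \<otimes>\<^bsub>M\<^esub> x" using central x y sub by auto
    then show ?thesis using x y sub by (auto simp: m_assoc)
  qed
  then have "(\<Union>x\<in>lower_central M k. \<Union>y\<in>carrier M. {x \<otimes>\<^bsub>M\<^esub> y \<otimes>\<^bsub>M\<^esub> inv\<^bsub>M\<^esub> x \<otimes>\<^bsub>M\<^esub> inv\<^bsub>M\<^esub> y}) \<subseteq> {\<one>\<^bsub>M\<^esub>}"
    by auto
  then have "lower_central M (Suc k) \<subseteq> {\<one>\<^bsub>M\<^esub>}"
    unfolding lower_central.simps by (intro generate_subgroup_incl triv_subgroup)
  moreover have "\<one>\<^bsub>M\<^esub> \<in> lower_central M (Suc k)"
    by (simp add: lower_central.simps(2) generate.one)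
  ultimately have "lower_central M (Suc k) = {\<one>\<^bsub>M\<^esub>}" by blast
  then show ?thesis using assms(1) unfolding nilpotent_group_def by blast
qed

lemma normal_map_nilpotent:
  assumes "normal_map M G n act" "nilpotent_group G"
  shows "nilpotent_group M"
proof -
  note D = normal_mapD[OF assms(1)]
  interpret group M by (rule D)
  show ?thesis
  proof (rule nilpotent_group_if_central_kernel[OF D(1) assms(2) D(3)])
    fix x y assume xy: "x \<in> carrier M" "y \<in> carrier M" and "n x = \<one>\<^bsub>G\<^esub>"
    \<comment> \<open>the Peiffer identity: \<open>y = y\<^sup>n\<^sup>(\<^sup>x\<^sup>) = x\<^sup>-\<^sup>1 y x\<close>\<close>
    then have "y = inv\<^bsub>M\<^esub> x \<otimes>\<^bsub>M\<^esub> (y \<otimes>\<^bsub>M\<^esub> x)"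
      using D(13)[of y x] D(10)[of y] by (simp add: m_assoc)
    then show "x \<otimes>\<^bsub>M\<^esub> y = y \<otimes>\<^bsub>M\<^esub> x"
      using xy by (metis inv_solve_left m_closed)
  qed
qed

section \<open>Iterated normal closures of a subgroup\<close>

primrec iterated_normal_closure :: "('a, 'm) monoid_scheme \<Rightarrow> 'a set \<Rightarrow> nat \<Rightarrow> 'a set" where
  "iterated_normal_closure G H 0 = carrier G"
| "iterated_normal_closure G H (Suc j) = generate G
     (\<Union>s\<in>iterated_normal_closure G H j. \<Union>h\<in>H. {inv\<^bsub>G\<^esub> s \<otimes>\<^bsub>G\<^esub> h \<otimes>\<^bsub>G\<^esub> s})"

lemma iterated_normal_closure_subset_carrier:
  assumes "group G" "H \<subseteq> carrier G"
  shows "iterated_normal_closure G H j \<subseteq> carrier G"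
proof -
  interpret group G by fact
  show ?thesis
  proof (induction j)
    case (Suc j)
    then show ?case
      unfolding iterated_normal_closure.simps using assms(2)
      by (intro generate_incl) (auto dest!: subsetD)
  qed simp
qed

text \<open>
  For \<open>s = l h\<^sub>1\<close> with \<open>l\<close> in the \<open>j\<close>-th term of the lower central series and \<open>h\<^sub>1 \<in> H\<close>, the conjugate of
  \<open>h \<in> H\<close> by \<open>l\<close> differs from \<open>h\<close> by a commutator that lies one term lower; conjugating by \<open>h\<^sub>1\<close>
  preserves both \<open>H\<close> and that term.
\<close>
lemma iterated_normal_closure_subset_lower_central_mult:
  assumes "group G" "subgroup H G"
  shows "iterated_normal_closure G H j \<subseteq> lower_central G j <#>\<^bsub>G\<^esub> H"
proof -
  interpret group G by fact
  interpret H: subgroup H G by fact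
  show ?thesis
  proof (induction j)
    case 0
    have "x \<in> carrier G <#>\<^bsub>G\<^esub> H" if "x \<in> carrier G" for x
      using that H.one_closed unfolding set_mult_def by (force intro: bexI[of _ x])
    then show ?case by auto
  next
    case (Suc j)
    interpret L: normal "lower_central G j" G using assms(1) by (rule lower_central_normal)
    let ?K = "lower_central G (Suc j)"
    have "inv\<^bsub>G\<^esub> s \<otimes>\<^bsub>G\<^esub> h \<otimes>\<^bsub>G\<^esub> s \<in> ?K <#>\<^bsub>G\<^esub> H"
      if s: "s \<in> iterated_normal_closure G H j" and h: "h \<in> H" for s h
    proof -
      obtain l h1 where l: "l \<in> lower_central G j" "h1 \<in> H" "s = l \<otimes>\<^bsub>G\<^esub> h1"
        using Suc.IH s by (auto simp: set_mult_def)
      note lc = L.mem_carrier[OF l(1)] H.mem_carrier[OF l(2)] H.mem_carrier[OF h]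
      let ?c = "inv\<^bsub>G\<^esub> l \<otimes>\<^bsub>G\<^esub> h \<otimes>\<^bsub>G\<^esub> inv\<^bsub>G\<^esub> (inv\<^bsub>G\<^esub> l) \<otimes>\<^bsub>G\<^esub> inv\<^bsub>G\<^esub> h"
      have "?c \<in> ?K"
        using l h by (intro commutator_in_lower_central L.m_inv_closed H.mem_carrier)
      then have "inv\<^bsub>G\<^esub> h1 \<otimes>\<^bsub>G\<^esub> ?c \<otimes>\<^bsub>G\<^esub> h1 \<in> ?K"
        using lc normal.inv_op_closed1[OF lower_central_normal[OF assms(1)]] by blast
      moreover have "inv\<^bsub>G\<^esub> h1 \<otimes>\<^bsub>G\<^esub> h \<otimes>\<^bsub>G\<^esub> h1 \<in> H"
        using l h by simp
      moreover have "inv\<^bsub>G\<^esub> s \<otimes>\<^bsub>G\<^esub> h \<otimes>\<^bsub>G\<^esub> s =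
          (inv\<^bsub>G\<^esub> h1 \<otimes>\<^bsub>G\<^esub> ?c \<otimes>\<^bsub>G\<^esub> h1) \<otimes>\<^bsub>G\<^esub> (inv\<^bsub>G\<^esub> h1 \<otimes>\<^bsub>G\<^esub> h \<otimes>\<^bsub>G\<^esub> h1)"
      proof -
        have "h1 \<otimes>\<^bsub>G\<^esub> (inv\<^bsub>G\<^esub> h1 \<otimes>\<^bsub>G\<^esub> z) = z" "inv\<^bsub>G\<^esub> h \<otimes>\<^bsub>G\<^esub> (h \<otimes>\<^bsub>G\<^esub> z) = z"
          if "z \<in> carrier G" for z
          using that lc by (simp_all flip: m_assoc)
        then show ?thesis using lc by (simp add: l(3) m_assoc inv_mult_group)
      qed
      ultimately show ?thesis unfolding set_mult_def by blast
    qed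
    moreover have "subgroup (?K <#>\<^bsub>G\<^esub> H) G"
      by (intro mult_norm_subgroup lower_central_normal assms)
    ultimately show ?case
      unfolding iterated_normal_closure.simps by (intro generate_subgroup_incl) auto
  qed
qed

lemma iterated_normal_closure_nilpotent:
  assumes "nilpotent_group G" "subgroup H G"
  obtains j where "iterated_normal_closure G H j \<subseteq> H"
proof -
  obtain k where G: "group G" and k: "lower_central G k = {\<one>\<^bsub>G\<^esub>}"
    using assms(1) by (auto simp: nilpotent_group_def)
  interpret group G by fact
  have "{\<one>\<^bsub>G\<^esub>} <#>\<^bsub>G\<^esub> H = H"
    using subgroup.mem_carrier[OF assms(2)] by (force simp: set_mult_def)
  then show thesis
    using that iterated_normal_closure_subset_lower_central_mult[OF G assms(2), of k] k by simp
qed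

lemma subgroup_normal_map:
  assumes "K \<lhd> G"
  shows "normal_map (G\<lparr>carrier := K\<rparr>) G (\<lambda>x. x) (conj_act G)"
proof -
  interpret normal K G by fact
  have "conj_act G m g \<in> K" if "m \<in> K" "g \<in> carrier G" for m g
    using that by (simp add: conj_act_def inv_op_closed1)
  moreover have "conj_act G m \<one>\<^bsub>G\<^esub> = m" if "m \<in> K" for m
    using that by (simp add: conj_act_def)
  ultimately have "right_action_by_automorphisms (G\<lparr>carrier := K\<rparr>) G (conj_act G)"
    by (intro right_action_by_automorphismsI) (auto simp: conj_act_simps is_group)
  then show ?thesis
    by (auto simp: normal_map_def hom_def is_group subgroup_is_group conj_act_def m_inv_consistent
        subgroup_axioms)
qed

text \<open>
  The homomorphism \<open>\<phi>\<close> factors through the inclusion into \<open>G\<close> of the normal subgroup generated by its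
  image. This inclusion is a normal map, so the universal property makes \<open>n\<close> factor through it, too.
\<close>
lemma normal_closure_image:
  fixes \<Gamma> :: "'a monoid" and G :: "'g monoid"
  assumes cl: "is_normal_closure TYPE('g) \<Gamma> G \<phi> N c n act"
    and "group \<Gamma>" "\<phi> \<in> hom \<Gamma> G"
  shows "n ` carrier N \<subseteq> iterated_normal_closure G (\<phi> ` carrier \<Gamma>) (Suc 0)"
proof -
  have "normal_map N G n act"
    using cl by (auto simp: is_normal_closure_def normal_factorization_def)
  then interpret group G by (rule normal_mapD)
  let ?C = "\<Union>s\<in>carrier G. \<Union>h\<in>\<phi> ` carrier \<Gamma>. {inv\<^bsub>G\<^esub> s \<otimes>\<^bsub>G\<^esub> h \<otimes>\<^bsub>G\<^esub> s}"
  let ?K = "generate G ?C"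
  have phi: "\<phi> a \<in> carrier G" if "a \<in> carrier \<Gamma>" for a
    using assms(3) that by (rule hom_in_carrier)
  have K: "?K \<lhd> G"
  proof (rule normal_generateI)
    fix h g assume "h \<in> ?C" and g: "g \<in> carrier G"
    then obtain s a where s: "s \<in> carrier G" "a \<in> carrier \<Gamma>"
      and h: "h = inv\<^bsub>G\<^esub> s \<otimes>\<^bsub>G\<^esub> \<phi> a \<otimes>\<^bsub>G\<^esub> s" by blast
    then have "g \<otimes>\<^bsub>G\<^esub> h \<otimes>\<^bsub>G\<^esub> inv\<^bsub>G\<^esub> g
        = inv\<^bsub>G\<^esub> (s \<otimes>\<^bsub>G\<^esub> inv\<^bsub>G\<^esub> g) \<otimes>\<^bsub>G\<^esub> \<phi> a \<otimes>\<^bsub>G\<^esub> (s \<otimes>\<^bsub>G\<^esub> inv\<^bsub>G\<^esub> g)"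
      using g phi by (simp add: inv_mult_group m_assoc)
    moreover have "s \<otimes>\<^bsub>G\<^esub> inv\<^bsub>G\<^esub> g \<in> carrier G"
      using s g by simp
    ultimately show "g \<otimes>\<^bsub>G\<^esub> h \<otimes>\<^bsub>G\<^esub> inv\<^bsub>G\<^esub> g \<in> ?C"
      using s by blast
  next
    show "?C \<subseteq> carrier G"
      using phi by auto
  qed
  have "\<phi> a \<in> ?C" if "a \<in> carrier \<Gamma>" for a
  proof -
    have "\<phi> a = inv\<^bsub>G\<^esub> \<one>\<^bsub>G\<^esub> \<otimes>\<^bsub>G\<^esub> \<phi> a \<otimes>\<^bsub>G\<^esub> \<one>\<^bsub>G\<^esub>" using phi[OF that] by simp
    then show ?thesis using that one_closed by blast
  qed
  then have "\<phi> \<in> hom \<Gamma> (G\<lparr>carrier := ?K\<rparr>)"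
    using assms(3) generate.incl[of _ ?C G] by (simp add: hom_def Pi_def)
  then have "normal_factorization \<Gamma> G \<phi> (G\<lparr>carrier := ?K\<rparr>) \<phi> (\<lambda>x. x) (conj_act G)"
    using subgroup_normal_map[OF K] by (simp add: normal_factorization_def)
  then obtain u where "normal_morphism G N n act (G\<lparr>carrier := ?K\<rparr>) (\<lambda>x. x) (conj_act G) u"
    using cl unfolding is_normal_closure_def by blast
  then have "n x \<in> ?K" if "x \<in> carrier N" for x
    using that by (auto simp: normal_morphism_def dest: hom_in_carrier)
  then show ?thesis by auto
qed

text \<open>
  Taking images under \<open>n\<close> costs one normal closure, by \<open>normal_closure_image\<close> for \<open>j = 0\<close>. Applied
  repeatedly along a tower, this confines the image of the stage \<open>i + j\<close> in the stage \<open>i\<close>.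
\<close>
lemma normal_closure_image_iterated:
  fixes \<Gamma> :: "'a monoid" and G :: "'g monoid"
  assumes cl: "is_normal_closure TYPE('g) \<Gamma> G \<phi> N c n act"
    and "group \<Gamma>" "\<phi> \<in> hom \<Gamma> G"
  shows "n ` iterated_normal_closure N (c ` carrier \<Gamma>) j
      \<subseteq> iterated_normal_closure G (\<phi> ` carrier \<Gamma>) (Suc j)"
proof (induction j)
  case 0
  show ?case using normal_closure_image[OF assms] by simp
next
  case (Suc j)
  have fac: "normal_factorization \<Gamma> G \<phi> N c n act"
    using cl by (simp add: is_normal_closure_def)
  then have nm: "normal_map N G n act" and nc: "\<And>a. a \<in> carrier \<Gamma> \<Longrightarrow> n (c a) = \<phi> a"
    and c: "c ` carrier \<Gamma> \<subseteq> carrier N"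
    by (auto simp: normal_factorization_def hom_def)
  note D = normal_mapD[OF nm]
  interpret group_hom N G n
    using D by (simp add: group_hom_def group_hom_axioms_def)
  let ?S = "iterated_normal_closure N (c ` carrier \<Gamma>) j"
  let ?C = "\<Union>s\<in>?S. \<Union>h\<in>c ` carrier \<Gamma>. {inv\<^bsub>N\<^esub> s \<otimes>\<^bsub>N\<^esub> h \<otimes>\<^bsub>N\<^esub> s}"
  have S: "?S \<subseteq> carrier N"
    by (rule iterated_normal_closure_subset_carrier[OF D(1) c])
  have "?C \<subseteq> carrier N"
    using S c by (auto dest!: subsetD)
  then have "n ` generate N ?C = generate G (n ` ?C)"
    by (simp add: generate_img)
  also have "\<dots> \<subseteq> iterated_normal_closure G (\<phi> ` carrier \<Gamma>) (Suc (Suc j))"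
    unfolding iterated_normal_closure.simps(2)[of G _ "Suc j"]
  proof (rule H.mono_generate, rule image_subsetI)
    fix x assume "x \<in> ?C"
    then obtain s a where s: "s \<in> ?S" "a \<in> carrier \<Gamma>" and x: "x = inv\<^bsub>N\<^esub> s \<otimes>\<^bsub>N\<^esub> c a \<otimes>\<^bsub>N\<^esub> s"
      by blast
    moreover have "s \<in> carrier N" "c a \<in> carrier N"
      using s S c by auto
    ultimately have "n x = inv\<^bsub>G\<^esub> (n s) \<otimes>\<^bsub>G\<^esub> \<phi> a \<otimes>\<^bsub>G\<^esub> n s"
      by (simp add: nc)
    moreover have "n s \<in> iterated_normal_closure G (\<phi> ` carrier \<Gamma>) (Suc j)"
      using Suc.IH s by blast
    ultimately show "n x \<in> (\<Union>s\<in>iterated_normal_closure G (\<phi> ` carrier \<Gamma>) (Suc j).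
        \<Union>h\<in>\<phi> ` carrier \<Gamma>. {inv\<^bsub>G\<^esub> s \<otimes>\<^bsub>G\<^esub> h \<otimes>\<^bsub>G\<^esub> s})"
      using s by blast
  qed
  finally show ?case by simp
qed

section \<open>Central extensions and normal closures\<close>

text \<open>
  An element of \<open>G\<close> acts on the second component through conjugation by any \<open>e \<in> E\<close> over its image in
  \<open>Q\<close>: the kernel of \<open>p\<close> is central, so the choice of \<open>e\<close> does not matter. For the image of
  \<open>(x', y') \<in> P\<close> one may choose \<open>e = y'\<close>, which is the Peiffer identity.
\<close>
lemma central_extension_pullback_normal_map:
  fixes G :: "'g monoid" and E :: "'e monoid"
  assumes "group G" "group E" "group Q"
    and p: "p \<in> hom E Q" and surj: "p ` carrier E = carrier Q" and q: "q \<in> hom G Q"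
    and central: "\<And>x y. x \<in> carrier E \<Longrightarrow> y \<in> carrier E \<Longrightarrow> p x = \<one>\<^bsub>Q\<^esub> \<Longrightarrow>
      x \<otimes>\<^bsub>E\<^esub> y = y \<otimes>\<^bsub>E\<^esub> x"
  defines "P \<equiv> (G \<times>\<times> E)\<lparr>carrier := {(x, y). x \<in> carrier G \<and> y \<in> carrier E \<and> q x = p y}\<rparr>"
  obtains act where "normal_map P G fst act"
proof -
  interpret G: group G by fact
  interpret E: group E by fact
  interpret Q: group Q by fact
  interpret p: group_hom E Q p
    using p by unfold_locales
  interpret q: group_hom G Q q
    using q by unfold_locales
  have conj_indep: "conj_act E x e = conj_act E x e'"
    if "x \<in> carrier E" "e \<in> carrier E" "e' \<in> carrier E" "p e = p e'" for x e e'
  proof -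
    have "p (e' \<otimes>\<^bsub>E\<^esub> inv\<^bsub>E\<^esub> e) = \<one>\<^bsub>Q\<^esub>" using that by simp
    then have z: "conj_act E x (e' \<otimes>\<^bsub>E\<^esub> inv\<^bsub>E\<^esub> e) = x"
      using that central[of "e' \<otimes>\<^bsub>E\<^esub> inv\<^bsub>E\<^esub> e" x]
      by (simp add: conj_act_def E.m_assoc E.inv_solve_left')
    have "conj_act E x e' = conj_act E x (e' \<otimes>\<^bsub>E\<^esub> inv\<^bsub>E\<^esub> e \<otimes>\<^bsub>E\<^esub> e)"
      using that by (simp add: E.m_assoc)
    also have "\<dots> = conj_act E x e"
      using that z by (subst conj_act_simps(4)) (auto simp: assms)
    finally show ?thesis ..
  qed
  define e where "e g = (SOME e. e \<in> carrier E \<and> p e = q g)" for g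
  have e: "e g \<in> carrier E" "p (e g) = q g" if "g \<in> carrier G" for g
  proof -
    have "\<exists>e. e \<in> carrier E \<and> p e = q g"
      using surj q.hom_closed[OF that] by (metis imageE)
    then have "e g \<in> carrier E \<and> p (e g) = q g"
      unfolding e_def by (rule someI_ex)
    then show "e g \<in> carrier E" "p (e g) = q g" by auto
  qed
  define act where "act = (\<lambda>(x, y) g. (conj_act G x g, conj_act E y (e g)))"
  have "(\<one>\<^bsub>G\<^esub>, \<one>\<^bsub>E\<^esub>) \<in> carrier P"
    by (simp add: P_def)
  then have "carrier P \<noteq> {}" by blast
  then have sub: "subgroup (carrier P) (G \<times>\<times> E)"
    by (intro group.subgroupI[OF DirProd_group[OF assms(1,2)]]) (auto simp: P_def assms)
  have P: "group P"
    using subgroup.subgroup_is_group[OF sub DirProd_group[OF assms(1,2)]] by (simp add: P_def)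
  have invP: "inv\<^bsub>P\<^esub> (x, y) = (inv\<^bsub>G\<^esub> x, inv\<^bsub>E\<^esub> y)" if "(x, y) \<in> carrier P" for x y
    using group.m_inv_consistent[OF DirProd_group[OF assms(1,2)] sub that] that
    by (auto simp: P_def assms)
  have "right_action_by_automorphisms P G act"
  proof (rule right_action_by_automorphismsI)
    fix m assume "m \<in> carrier P"
    then show "act m \<one>\<^bsub>G\<^esub> = m"
      using conj_indep[of "snd m" "e \<one>\<^bsub>G\<^esub>" "\<one>\<^bsub>E\<^esub>"] e[of "\<one>\<^bsub>G\<^esub>"]
      by (auto simp: P_def act_def conj_act_simps assms)
  next
    fix m g h assume "m \<in> carrier P" "g \<in> carrier G" "h \<in> carrier G"
    then show "act m (g \<otimes>\<^bsub>G\<^esub> h) = act (act m g) h"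
      using conj_indep[of "snd m" "e (g \<otimes>\<^bsub>G\<^esub> h)" "e g \<otimes>\<^bsub>E\<^esub> e h"] e[of g] e[of h]
        e[of "g \<otimes>\<^bsub>G\<^esub> h"]
      by (auto simp: P_def act_def conj_act_simps assms)
  next
    fix m g assume "m \<in> carrier P" "g \<in> carrier G"
    then show "act m g \<in> carrier P"
      using e[of g] by (auto simp: P_def act_def conj_act_def)
  qed (use e in \<open>auto simp: P_def act_def conj_act_simps assms\<close>)
  moreover have "act m (fst m') = inv\<^bsub>P\<^esub> m' \<otimes>\<^bsub>P\<^esub> m \<otimes>\<^bsub>P\<^esub> m'"
    if "m \<in> carrier P" "m' \<in> carrier P" for m m'
  proof -
    obtain x y x' y' where m: "m = (x, y)" "m' = (x', y')" by (cases m; cases m')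
    have c: "x \<in> carrier G" "y \<in> carrier E" "x' \<in> carrier G" "y' \<in> carrier E" "q x' = p y'"
      using that by (auto simp: m P_def)
    have "conj_act E y (e x') = conj_act E y y'"
      using c e[of x'] by (intro conj_indep) auto
    then show ?thesis
      using invP[of x' y'] that by (simp add: m act_def conj_act_def) (simp add: P_def)
  qed
  ultimately have "normal_map P G fst act"
    using P assms(1) by (auto simp: normal_map_def hom_def P_def act_def conj_act_def)
  then show thesis by (rule that)
qed

text \<open>
  A normal closure has the lifting property against central extensions: pull the extension back to \<open>G\<close>, factor \<open>\<phi>\<close> through the pullback by means of \<open>\<theta>\<close>,
  and project to \<open>E\<close>.
\<close>
lemma normal_closure_central_lift:
  fixes G :: "'g monoid" and E :: "'e monoid"
  assumes cl: "is_normal_closure TYPE('g \<times> 'e) \<Gamma> G \<phi> N c n act"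
    and "group E" "group Q"
    and p: "p \<in> hom E Q" and surj: "p ` carrier E = carrier Q" and q: "q \<in> hom G Q"
    and central: "\<And>x y. x \<in> carrier E \<Longrightarrow> y \<in> carrier E \<Longrightarrow> p x = \<one>\<^bsub>Q\<^esub> \<Longrightarrow>
      x \<otimes>\<^bsub>E\<^esub> y = y \<otimes>\<^bsub>E\<^esub> x"
    and \<phi>: "\<phi> \<in> hom \<Gamma> G" and \<theta>: "\<theta> \<in> hom \<Gamma> E"
    and compat: "\<And>a. a \<in> carrier \<Gamma> \<Longrightarrow> q (\<phi> a) = p (\<theta> a)"
  obtains u where "u \<in> hom N E" "\<And>a. a \<in> carrier \<Gamma> \<Longrightarrow> u (c a) = \<theta> a"
proof -
  have "normal_map N G n act"
    using cl by (auto simp: is_normal_closure_def normal_factorization_def)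
  then have G: "group G" by (rule normal_mapD)
  let ?P = "(G \<times>\<times> E)\<lparr>carrier := {(x, y). x \<in> carrier G \<and> y \<in> carrier E \<and> q x = p y}\<rparr>"
  obtain act' where nm: "normal_map ?P G fst act'"
    using central_extension_pullback_normal_map[OF G assms(2,3) p surj q central] by blast
  have "normal_factorization \<Gamma> G \<phi> ?P (\<lambda>a. (\<phi> a, \<theta> a)) fst act'"
    using nm \<phi> \<theta> compat by (auto simp: normal_factorization_def hom_def)
  then obtain v where v: "normal_morphism G N n act ?P fst act' v"
      "\<And>a. a \<in> carrier \<Gamma> \<Longrightarrow> v (c a) = (\<phi> a, \<theta> a)"
    using cl unfolding is_normal_closure_def by blast
  have "snd \<circ> v \<in> hom N E"
    using v(1) by (fastforce simp: normal_morphism_def hom_def Pi_def mult_DirProd')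
  then show thesis
    using that[of "snd \<circ> v"] v(2) by simp
qed

lemma tower_to_lower_central_quotient:
  fixes \<Gamma> :: "'a monoid" and G :: "'b monoid"
  assumes "group \<Gamma>" "group G" "\<phi> \<in> hom \<Gamma> G"
  shows "\<exists>q \<in> hom (tower_group \<Gamma> G \<phi> i) (\<Gamma> Mod lower_central \<Gamma> i).
    \<forall>a\<in>carrier \<Gamma>. q (tower_map \<Gamma> G \<phi> i a) = lower_central \<Gamma> i #>\<^bsub>\<Gamma>\<^esub> a"
proof (induction i)
  interpret group \<Gamma> by fact
  case 0
  have "(\<lambda>x. carrier \<Gamma>) \<in> hom (tower_group \<Gamma> G \<phi> 0) (\<Gamma> Mod carrier \<Gamma>)"
    using coset_join2[OF one_closed subgroup_self one_closed]
    by (auto simp: hom_def carrier_FactGroup subgroup_mult_id[OF subgroup_self]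
        intro!: image_eqI[of _ _ "\<one>\<^bsub>\<Gamma>\<^esub>"])
  then show ?case
    using coset_join2[OF _ subgroup_self] by auto
next
  interpret group \<Gamma> by fact
  case (Suc i)
  let ?L = "lower_central \<Gamma> i" and ?K = "lower_central \<Gamma> (Suc i)"
  interpret L: normal ?L \<Gamma> using assms(1) by (rule lower_central_normal)
  interpret K: normal ?K \<Gamma> using assms(1) by (rule lower_central_normal)
  obtain q where q: "q \<in> hom (tower_group \<Gamma> G \<phi> i) (\<Gamma> Mod ?L)"
    "\<And>a. a \<in> carrier \<Gamma> \<Longrightarrow> q (tower_map \<Gamma> G \<phi> i a) = ?L #>\<^bsub>\<Gamma>\<^esub> a"
    using Suc.IH by blast
  have KL: "?K \<subseteq> ?L" using assms(1) by (rule lower_central_Suc_subset)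
  obtain p where p: "p \<in> hom (\<Gamma> Mod ?K) (\<Gamma> Mod ?L)"
    "\<And>a. a \<in> carrier \<Gamma> \<Longrightarrow> p (?K #>\<^bsub>\<Gamma>\<^esub> a) = ?L #>\<^bsub>\<Gamma>\<^esub> a"
  proof (rule FactGroup_universal[OF L.r_coset_hom_Mod K.normal_axioms])
    fix x y assume xy: "x \<in> carrier \<Gamma>" "y \<in> carrier \<Gamma>" "?K #>\<^bsub>\<Gamma>\<^esub> x = ?K #>\<^bsub>\<Gamma>\<^esub> y"
    then have "y \<in> ?L #>\<^bsub>\<Gamma>\<^esub> x"
    proof -
      have "?K #>\<^bsub>\<Gamma>\<^esub> x \<subseteq> ?L #>\<^bsub>\<Gamma>\<^esub> x"
        using KL unfolding r_coset_def by blast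
      then show ?thesis
        using repr_independenceD[OF K.subgroup_axioms xy(2,3)] by blast
    qed
    then show "?L #>\<^bsub>\<Gamma>\<^esub> x = ?L #>\<^bsub>\<Gamma>\<^esub> y"
      using xy L.subgroup_axioms by (intro repr_independence)
  qed (rule that)
  have central: "x \<otimes>\<^bsub>\<Gamma> Mod ?K\<^esub> y = y \<otimes>\<^bsub>\<Gamma> Mod ?K\<^esub> x"
    if x: "x \<in> carrier (\<Gamma> Mod ?K)" and y: "y \<in> carrier (\<Gamma> Mod ?K)" and px: "p x = \<one>\<^bsub>\<Gamma> Mod ?L\<^esub>" for x y
  proof -
    obtain a b where a: "a \<in> carrier \<Gamma>" "x = ?K #>\<^bsub>\<Gamma>\<^esub> a" and b: "b \<in> carrier \<Gamma>" "y = ?K #>\<^bsub>\<Gamma>\<^esub> b"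
      using x y by (auto simp: carrier_FactGroup)
    have "?L #>\<^bsub>\<Gamma>\<^esub> a = ?L" using px p(2)[OF a(1)] a by simp
    then have "a \<in> ?L" using coset_join1[OF _ a(1) L.subgroup_axioms] by blast
    then have "a \<otimes>\<^bsub>\<Gamma>\<^esub> b \<otimes>\<^bsub>\<Gamma>\<^esub> inv\<^bsub>\<Gamma>\<^esub> a \<otimes>\<^bsub>\<Gamma>\<^esub> inv\<^bsub>\<Gamma>\<^esub> b \<in> ?K"
      using b by (intro commutator_in_lower_central)
    then have "a \<otimes>\<^bsub>\<Gamma>\<^esub> b \<otimes>\<^bsub>\<Gamma>\<^esub> inv\<^bsub>\<Gamma>\<^esub> a \<otimes>\<^bsub>\<Gamma>\<^esub> inv\<^bsub>\<Gamma>\<^esub> b \<otimes>\<^bsub>\<Gamma>\<^esub> (b \<otimes>\<^bsub>\<Gamma>\<^esub> a) \<in> ?K #>\<^bsub>\<Gamma>\<^esub> (b \<otimes>\<^bsub>\<Gamma>\<^esub> a)"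
      using a b K.subset by (intro rcosI) auto
    also have "a \<otimes>\<^bsub>\<Gamma>\<^esub> b \<otimes>\<^bsub>\<Gamma>\<^esub> inv\<^bsub>\<Gamma>\<^esub> a \<otimes>\<^bsub>\<Gamma>\<^esub> inv\<^bsub>\<Gamma>\<^esub> b \<otimes>\<^bsub>\<Gamma>\<^esub> (b \<otimes>\<^bsub>\<Gamma>\<^esub> a) = a \<otimes>\<^bsub>\<Gamma>\<^esub> b"
    proof -
      have "inv\<^bsub>\<Gamma>\<^esub> b \<otimes>\<^bsub>\<Gamma>\<^esub> (b \<otimes>\<^bsub>\<Gamma>\<^esub> a) = a" using a b by (simp flip: m_assoc)
      then show ?thesis using a b by (simp add: m_assoc)
    qed
    finally have "?K #>\<^bsub>\<Gamma>\<^esub> (b \<otimes>\<^bsub>\<Gamma>\<^esub> a) = ?K #>\<^bsub>\<Gamma>\<^esub> (a \<otimes>\<^bsub>\<Gamma>\<^esub> b)"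
      using a b K.subgroup_axioms by (intro repr_independence) auto
    then show ?thesis using a b by (simp add: K.rcos_sum)
  qed
  have surj: "p ` carrier (\<Gamma> Mod ?K) = carrier (\<Gamma> Mod ?L)"
    using p(2) by (force simp: carrier_FactGroup)
  show ?case
  proof (rule normal_closure_central_lift[OF tower_is_normal_closure[OF assms, of i]
        K.factorgroup_is_group L.factorgroup_is_group p(1) surj q(1) central
        tower_stage(2)[OF assms] K.r_coset_hom_Mod])
    show "q (tower_map \<Gamma> G \<phi> i a) = p (?K #>\<^bsub>\<Gamma>\<^esub> a)" if "a \<in> carrier \<Gamma>" for a
      using that by (simp only: q(2) p(2))
  qed blast+
qed

section \<open>The limit of the tower\<close>

lemma tower_map_kernel:
  assumes "group \<Gamma>" "group G" "\<phi> \<in> hom \<Gamma> G" "a \<in> carrier \<Gamma>"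
    and eq: "tower_map \<Gamma> G \<phi> i a = \<one>\<^bsub>tower_group \<Gamma> G \<phi> i\<^esub>"
  shows "a \<in> lower_central \<Gamma> i"
proof -
  interpret group \<Gamma> by fact
  interpret L: normal "lower_central \<Gamma> i" \<Gamma> using assms(1) by (rule lower_central_normal)
  obtain q where q: "q \<in> hom (tower_group \<Gamma> G \<phi> i) (\<Gamma> Mod lower_central \<Gamma> i)"
    "\<And>a. a \<in> carrier \<Gamma> \<Longrightarrow> q (tower_map \<Gamma> G \<phi> i a) = lower_central \<Gamma> i #>\<^bsub>\<Gamma>\<^esub> a"
    using tower_to_lower_central_quotient[OF assms(1-3), of i] by blast
  have q1: "q \<one>\<^bsub>tower_group \<Gamma> G \<phi> i\<^esub> = lower_central \<Gamma> i"
    using hom_one[OF q(1) tower_stage(1)[OF assms(1-3)] L.factorgroup_is_group] by simp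
  have "lower_central \<Gamma> i #>\<^bsub>\<Gamma>\<^esub> a = lower_central \<Gamma> i"
    by (rule q(2)[OF assms(4), unfolded eq q1, symmetric])
  then show ?thesis
    using coset_join1[OF _ assms(4) L.subgroup_axioms] by blast
qed

lemma tower_group_nilpotent:
  fixes \<Gamma> :: "'a monoid" and G :: "'b monoid"
  assumes "group \<Gamma>" "nilpotent_group G" "\<phi> \<in> hom \<Gamma> G"
  shows "nilpotent_group (tower_group \<Gamma> G \<phi> i)"
proof -
  have G: "group G" using assms(2) by (simp add: nilpotent_group_def)
  show ?thesis
  proof (induction i)
    case 0
    let ?B = "base_group G :: ('a, 'b) stage monoid"
    have iso: "Base \<in> iso G ?B" and B: "group ?B"
      using Base_iso[OF G] by blast+
    have "inv_into (carrier G) Base \<in> iso ?B G"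
      by (rule group.iso_set_sym[OF G iso])
    then obtain f where hom: "f \<in> hom ?B G" and inj: "inj_on f (carrier ?B)"
      by (auto simp: iso_def bij_betw_def)
    interpret B: group ?B by (rule B)
    have "nilpotent_group ?B"
    proof (rule nilpotent_group_if_central_kernel[OF B assms(2) hom])
      fix x y assume xy: "x \<in> carrier ?B" "y \<in> carrier ?B" "f x = \<one>\<^bsub>G\<^esub>"
      then have "x = \<one>\<^bsub>?B\<^esub>"
        using inj hom_one[OF hom B G] by (metis B.one_closed inj_onD)
      then show "x \<otimes>\<^bsub>?B\<^esub> y = y \<otimes>\<^bsub>?B\<^esub> x" using xy by simp
    qed
    then show ?case by (simp add: tower_simps)
  next
    case (Suc i)
    have "normal_map (tower_group \<Gamma> G \<phi> (Suc i)) (tower_group \<Gamma> G \<phi> i)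
        (tower_normal_map \<Gamma> G \<phi> i) (tower_action \<Gamma> G \<phi> i)"
      using tower_is_normal_closure[OF assms(1) G assms(3)]
      unfolding is_normal_closure_def normal_factorization_def by blast
    then show ?case using Suc.IH by (rule normal_map_nilpotent)
  qed
qed

text \<open>
  Every coordinate of a point of the limit is the image of later coordinates and thus lies in all
  iterated normal closures of the image of \<open>\<Gamma>\<close>.
\<close>
lemma tower_limit_coordinate:
  assumes "group \<Gamma>" "nilpotent_group G" "\<phi> \<in> hom \<Gamma> G"
    and x: "x \<in> carrier (tower_limit \<Gamma> G \<phi>)"
  shows "x i \<in> tower_map \<Gamma> G \<phi> i ` carrier \<Gamma>"
proof -
  have G: "group G" using assms(2) by (simp add: nilpotent_group_def)
  note stage = tower_stage[OF assms(1) G assms(3)]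
  let ?H = "\<lambda>i. tower_map \<Gamma> G \<phi> i ` carrier \<Gamma>"
  have mem: "x i \<in> iterated_normal_closure (tower_group \<Gamma> G \<phi> i) (?H i) j" for i j
  proof (induction j arbitrary: i)
    case 0
    show ?case using x by (auto simp: tower_limit_def inverse_limit_def)
  next
    case (Suc j)
    have "x i = tower_normal_map \<Gamma> G \<phi> i (x (Suc i))"
      using x by (simp add: tower_limit_def inverse_limit_def)
    then show ?case
      using normal_closure_image_iterated[OF tower_is_normal_closure[OF assms(1) G assms(3)]
          assms(1) stage(2)] Suc.IH[of "Suc i"] by blast
  qed
  interpret group_hom \<Gamma> "tower_group \<Gamma> G \<phi> i" "tower_map \<Gamma> G \<phi> i"
    using assms(1) stage by (simp add: group_hom_def group_hom_axioms_def)
  obtain j where "iterated_normal_closure (tower_group \<Gamma> G \<phi> i) (?H i) j \<subseteq> ?H i"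
    using iterated_normal_closure_nilpotent[OF tower_group_nilpotent[OF assms(1-3)] img_is_subgroup]
    by blast
  then show ?thesis using mem by blast
qed

theorem theorem1:
  fixes \<Gamma> :: "'a monoid" and G :: "'b monoid" and \<phi> :: "'a \<Rightarrow> 'b"
  assumes "nilpotent_group \<Gamma>" and "nilpotent_group G" and "\<phi> \<in> hom \<Gamma> G"
  shows "tower_limit_map \<Gamma> G \<phi> \<in> iso \<Gamma> (tower_limit \<Gamma> G \<phi>)"
proof -
  have G: "group G" using assms(2) by (simp add: nilpotent_group_def)
  obtain k where \<Gamma>: "group \<Gamma>" and k: "lower_central \<Gamma> k = {\<one>\<^bsub>\<Gamma>\<^esub>}"
    using assms(1) by (auto simp: nilpotent_group_def)
  let ?f = "tower_limit_map \<Gamma> G \<phi>" and ?T = "tower_map \<Gamma> G \<phi>" and ?p = "tower_normal_map \<Gamma> G \<phi>"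
  note stage = tower_stage[OF \<Gamma> G assms(3)]
  have hom: "group_hom \<Gamma> (tower_group \<Gamma> G \<phi> i) (?T i)" for i
    using \<Gamma> stage by (simp add: group_hom_def group_hom_axioms_def)
  have compat: "?p i (?T (Suc i) a) = ?T i a" if "a \<in> carrier \<Gamma>" for i a
    using tower_is_normal_closure[OF \<Gamma> G assms(3)] that
    unfolding is_normal_closure_def normal_factorization_def by blast
  have T_inj: "inj_on (?T i) (carrier \<Gamma>)" if "i \<ge> k" for i
  proof -
    have "lower_central \<Gamma> i \<subseteq> lower_central \<Gamma> k"
      using lower_central_Suc_subset[OF \<Gamma>] that by (rule lift_Suc_antimono_le)
    then show ?thesis
      using tower_map_kernel[OF \<Gamma> G assms(3), of _ i] k
      by (auto simp: group_hom.inj_iff_trivial_ker[OF hom] kernel_def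
          group_hom.hom_one[OF hom] monoid.one_closed[OF group.is_monoid[OF \<Gamma>]])
  qed
  have "?f \<in> hom \<Gamma> (tower_limit \<Gamma> G \<phi>)"
    using stage(2) compat
    by (auto simp: hom_def tower_limit_def inverse_limit_def tower_limit_map_def Pi_def)
  moreover have "inj_on ?f (carrier \<Gamma>)"
  proof (rule inj_onI)
    fix a b assume ab: "a \<in> carrier \<Gamma>" "b \<in> carrier \<Gamma>" and eq: "?f a = ?f b"
    have "?T k a = ?T k b" using fun_cong[OF eq, of k] by (simp add: tower_limit_map_def)
    then show "a = b" using T_inj[of k] ab by (simp add: inj_onD)
  qed
  moreover have "x \<in> ?f ` carrier \<Gamma>" if x: "x \<in> carrier (tower_limit \<Gamma> G \<phi>)" for x
  proof -
    have px: "?p i (x (Suc i)) = x i" for i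
      using x by (simp add: tower_limit_def inverse_limit_def)
    obtain a where a: "a \<in> carrier \<Gamma>" "x k = ?T k a"
      using tower_limit_coordinate[OF \<Gamma> assms(2,3) x] by blast
    \<comment> \<open>an element of \<open>\<Gamma>\<close> over the coordinate \<open>i + 1\<close> also lies over the coordinate \<open>i\<close>, where it is unique\<close>
    have up: "x i = ?T i a" if "i \<ge> k" for i
      using that
    proof (induction i rule: dec_induct)
      case base
      show ?case by (rule a)
    next
      case (step i)
      obtain b where b: "b \<in> carrier \<Gamma>" "x (Suc i) = ?T (Suc i) b"
        using tower_limit_coordinate[OF \<Gamma> assms(2,3) x] by blast
      then have "?T i b = ?T i a"
        using step px[of i] compat by simp
      then have "b = a"
        using T_inj[OF step(1)] a b by (auto dest: inj_onD)
      then show ?case using b by simp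
    qed
    have down: "x i = ?T i a" if "i \<le> k" for i
      using that
    proof (induction i rule: inc_induct)
      case base
      show ?case by (rule a)
    next
      case (step i)
      then show ?case using px[of i] compat[OF a(1), of i] by simp
    qed
    have "x = ?f a"
    proof (rule ext)
      fix i
      show "x i = ?f a i"
        using up[of i] down[of i] by (cases "k \<le> i") (simp_all add: tower_limit_map_def)
    qed
    then show ?thesis using a by blast
  qed
  ultimately show ?thesis
    by (auto simp: iso_def bij_betw_def dest: hom_in_carrier)
qed

end
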